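(* There are constants $c, \varepsilon_0 > 0$ such that for all $\varepsilon < \varepsilon_0$ the following holds. Let $A$ and $B$ be finite non-empty subsets of $\mathbb{Z}$ with $n = |A| = |B|$. Suppose that for any four elements $b_1, b_2, b_3, b_4 \in B$ we have $$|A + \{b_1, b_2, b_3, b_4\}| \leq (2+\varepsilon) n - 1.$$ Then there are arithmetic progressions $P, Q$ in $\mathbb{Z}$, each of size $\lfloor (1 + \varepsilon + c\varepsilon^2) n \rfloor$ and with the same common difference, such that $$B \subset Q \quad\text{and}\quad |A \,\Delta\, P| \leq c\,\varepsilon n.$$
   Context: For sets $S, T \subset \mathbb{Z}$, $S + T = \{s + t : s \in S,\ t \in T\}$, and $S \,\Delta\, T$ denotes the symmetric difference. The elements $b_1, b_2, b_3, b_4$ range over $B$ and are not required to be distinct. An arithmetic progression of size $N$ and common difference $d \geq 1$ in $\mathbb{Z}$ is a set of the form $\{a, a+d, \dots, a+(N-1)d\}$. *)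

theory Defs
  imports Complex_Main "HOL-Library.Set_Algebras"
begin

definition is_arith_prog :: "int \<Rightarrow> nat \<Rightarrow> int set \<Rightarrow> bool"
  where "is_arith_prog d N P \<longleftrightarrow> d \<ge> 1 \<and> (\<exists>a. P = {a + int i * d | i. i < N})"

end

theory Submission
  imports Defs
begin

text \<open>
Translate and rescale so that \<open>min B = 0\<close> and \<open>Gcd B = 1\<close>, and write \<open>m = max B\<close> and
\<open>e = \<epsilon> n\<close>. Two of the four shifts are always \<open>0\<close> and \<open>m\<close>; the other two,
\<open>b\<close> and \<open>b'\<close>, are free. The pair \<open>0, m\<close> already produces one extra element in each
residue class modulo \<open>m\<close> that \<open>A\<close> meets, so the free shifts can bring few elements into vacant
classes.

The first point is that \<open>m\<close> is close to \<open>n\<close>. Averaged over \<open>B\<close>, a shift brings at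
least \<open>n - 1 - k\<close> elements into vacant classes, where \<open>k\<close> is the number of occupied ones, and no
two shifts together may bring more than \<open>n - 1 - k + e\<close>. Hence almost all shifts fill the same vacant classes
with the same multiplicities, mostly one, and this is possible only if \<open>k\<close> is nearly \<open>n - 1\<close>
(\<open>few_missing_residues\<close>). Then every element of \<open>B\<close> is an almost-period of the set of occupied
classes, which has few almost-periods; so \<open>B - B\<close> modulo \<open>m\<close> is a subgroup, and it is everything
because \<open>Gcd B = 1\<close>. Thus \<open>m\<close> is at most \<open>n\<close> up to a small factor
(\<open>near_extremal_modulus\<close>). If \<open>n\<close> is below an absolute constant, this says that \<open>B\<close> is
an interval and that equality holds everywhere, and the theorem follows at once (\<open>extremal_case\<close>).

Next, \<open>A\<close> is roughly an interval. For most \<open>a\<close> and \<open>b\<close> the sum \<open>a + b\<close>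
lies in \<open>A\<close> or in \<open>A + m\<close>, so most pairs of elements of \<open>A\<close> have distance at most
\<open>m\<close>. Cut \<open>A\<close> at its median and compare it with the interval of \<open>n\<close> integers that has
as many elements of \<open>A\<close> on each side of the cut. The residue class of a gap of the interval is usually occupied,
by an element one period further on, and that element forms a distant pair with every point of \<open>A\<close> beyond the
near end of the interval. So there are few such points (\<open>crude_stability\<close>).

This rough structure improves itself. Let \<open>v\<close> be the total defect: the points of \<open>A\<close> outside the
interval plus the number of elements that \<open>B\<close> lacks in \<open>{0..m}\<close>. In the sumset, the part to the
left of the cut, the \<open>m\<close> integers that follow, and the rest can be counted separately. A suitable free shift
covers all but \<open>O(v\<^sup>2/n)\<close> of the middle part, since each of the at most \<open>v\<close> uncovered points
is missed by a proportion \<open>O(v/n)\<close> of the shifts. This bounds the number of elements that \<open>B\<close> lacks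
by \<open>e + O(v\<^sup>2/n)\<close> (\<open>few_far_gaps\<close>). It also shows that a shift by any \<open>b\<close> in
\<open>B\<close> creates few new elements at either end of \<open>A\<close> (\<open>few_inversions\<close>). Applied to
shifts whose length is comparable to the number of stray points, this bounds that number
(\<open>few_inversions_left\<close>). Together, \<open>v = O(e + v\<^sup>2/n)\<close>; as \<open>v/n\<close> is already
small, \<open>v = O(e)\<close>, and then \<open>B\<close> lacks only \<open>e + O(e\<^sup>2/n)\<close> elements, which is
where the term \<open>c \<epsilon>\<^sup>2\<close> comes from (\<open>stability\<close>).

The final estimates carry no additive constants, so that the conclusion is exact when \<open>\<epsilon> n\<close> is small.
\<close>


section \<open>Averaging\<close>

text \<open>
Double counting: if each point of \<open>U\<close> is bad for few choices of \<open>b\<close>, then some \<open>b\<close> is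
bad for few points. It replaces a random choice of \<open>b\<close>.
\<close>
lemma average_exists:
  fixes U :: "'a set" and S :: "'b set"
  assumes "finite U" "finite S" "S \<noteq> {}"
    and "\<And>z. z \<in> U \<Longrightarrow> card {b \<in> S. R z b} \<le> v"
  shows "\<exists>b\<in>S. card {z \<in> U. R z b} * card S \<le> v * card U"
proof (rule ccontr)
  assume "\<not> ?thesis"
  hence less: "v * card U < card {z \<in> U. R z b} * card S" if "b \<in> S" for b
    using that by force
  have "card S * (v * card U) = (\<Sum>b\<in>S. v * card U)" by simp
  also have "\<dots> < (\<Sum>b\<in>S. card {z \<in> U. R z b} * card S)"
    using assms less by (intro sum_strict_mono) auto
  also have "\<dots> = card S * (\<Sum>b\<in>S. card {z \<in> U. R z b})"
    by (simp add: sum_distrib_left mult.commute)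
  also have "(\<Sum>b\<in>S. card {z \<in> U. R z b}) = (\<Sum>z\<in>U. card {b \<in> S. R z b})"
    using assms by (intro sum_multicount_gen) auto
  also have "card S * \<dots> \<le> card S * (v * card U)"
    using assms sum_bounded_above[of U "\<lambda>z. card {b \<in> S. R z b}" v]
    by (intro mult_le_mono2) (simp add: mult.commute)
  finally show False by simp
qed

lemma sum_periodic_shift:
  fixes g :: "int \<Rightarrow> 'a::comm_monoid_add"
  assumes "m > 0" and per: "\<And>x. g (x mod m) = g x"
  shows "(\<Sum>s\<in>{0..<m}. g (s + c)) = (\<Sum>s\<in>{0..<m}. g s)"
proof -
  have "bij_betw (\<lambda>s. (s + c) mod m) {0..<m} {0..<m}"
  proof (rule bij_betw_byWitness[where f' = "\<lambda>s. (s - c) mod m"])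
    show "\<forall>a\<in>{0..<m}. ((a + c) mod m - c) mod m = a"
      by (auto simp: mod_diff_left_eq)
    show "\<forall>a\<in>{0..<m}. ((a - c) mod m + c) mod m = a"
      by (auto simp: mod_add_left_eq)
  qed (use assms in auto)
  hence "(\<Sum>s\<in>{0..<m}. g ((s + c) mod m)) = (\<Sum>s\<in>{0..<m}. g s)"
    by (rule sum.reindex_bij_betw)
  thus ?thesis by (simp add: per)
qed

section \<open>Residues modulo the diameter of B\<close>

text \<open>
The normalised situation. Only quadruples that contain \<open>0 = min B\<close> and \<open>m = max B\<close> are used, and
the real number \<open>e\<close> stands for \<open>\<epsilon> n\<close>.
\<close>
locale shift_pair =
  fixes A B :: "int set" and m :: int and n :: nat and e :: real
  assumes finA: "finite A" and finB: "finite B"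
    and cardA: "card A = n" and cardB: "card B = n" and n2: "n \<ge> 2"
    and zeroB: "0 \<in> B" and mB: "m \<in> B" and Bsub: "B \<subseteq> {0..m}"
    and four: "\<And>b b'. b \<in> B \<Longrightarrow> b' \<in> B \<Longrightarrow>
      real (card (A + {0, m, b, b'})) \<le> 2 * real n - 1 + e"
begin

lemma m_pos: "m > 0"
proof (rule ccontr)
  assume "\<not> m > 0"
  hence "B \<subseteq> {0}" using Bsub by auto
  hence "card B \<le> 1" using card_mono[of "{0}" B] by simp
  thus False using cardB n2 by simp
qed

lemma m_ge: "int n \<le> m + 1"
  using card_mono[OF _ Bsub] cardB m_pos by simp

lemma finite_residues [simp]: "finite {s. 0 \<le> s \<and> s < m \<and> P s}"
  by (rule finite_subset[of _ "{0..<m}"]) auto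

definition fibre :: "int \<Rightarrow> nat" where
  "fibre x = card {a \<in> A. a mod m = x mod m}"

definition occupied :: "int set" where
  "occupied = {s \<in> {0..<m}. fibre s > 0}"

definition vacant :: "int set" where
  "vacant = {s \<in> {0..<m}. fibre s = 0}"

definition num_occupied :: nat where
  "num_occupied = card occupied"

lemma fibre_mod [simp]: "fibre (x mod m) = fibre x"
  by (simp add: fibre_def)

lemma fibre_mod_diff [simp]: "fibre (x mod m - y) = fibre (x - y)"
  by (metis mod_diff_left_eq fibre_mod)

lemma fibre_mod_add [simp]: "fibre (x mod m + y) = fibre (x + y)"
  by (metis mod_add_left_eq fibre_mod)

lemma sum_fibre: "(\<Sum>s\<in>{0..<m}. fibre s) = n"
proof -
  have "(\<Sum>s\<in>{0..<m}. fibre s) = (\<Sum>s\<in>{0..<m}. card {a \<in> A. a mod m = s})"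
    by (intro sum.cong) (auto simp: fibre_def)
  also have "\<dots> = card (\<Union>s\<in>{0..<m}. {a \<in> A. a mod m = s})"
    using finA by (intro card_UN_disjoint [symmetric]) auto
  also have "(\<Union>s\<in>{0..<m}. {a \<in> A. a mod m = s}) = A"
    using m_pos by auto
  finally show ?thesis using cardA by simp
qed

lemma num_occupied_plus_vacant: "int num_occupied + int (card vacant) = m"
proof -
  have "num_occupied + card vacant = card ({s \<in> {0..<m}. fibre s > 0} \<union> vacant)"
    unfolding num_occupied_def occupied_def vacant_def by (intro card_Un_disjoint [symmetric]) auto
  also have "{s \<in> {0..<m}. fibre s > 0} \<union> vacant = {0..<m}" by (auto simp: vacant_def)
  finally show ?thesis using m_pos by simp
qed

lemma card_class_image:
  "card {x \<in> (\<lambda>a. a + b) ` A. x mod m = s mod m} = fibre (s - b)"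
proof -
  have "{x \<in> (\<lambda>a. a + b) ` A. x mod m = s mod m} = (\<lambda>a. a + b) ` {a \<in> A. a mod m = (s - b) mod m}"
    by (auto simp: mod_eq_dvd_iff algebra_simps)
  thus ?thesis by (simp add: card_image fibre_def)
qed

lemma card_sumset_classes:
  assumes "finite C"
  shows "card C = (\<Sum>s\<in>{0..<m}. card {x \<in> C. x mod m = s})"
proof -
  have "(\<Sum>s\<in>{0..<m}. card {x \<in> C. x mod m = s}) = card (\<Union>s\<in>{0..<m}. {x \<in> C. x mod m = s})"
    using assms by (intro card_UN_disjoint [symmetric]) auto
  also have "(\<Union>s\<in>{0..<m}. {x \<in> C. x mod m = s}) = C"
    using m_pos by auto
  finally show ?thesis by simp
qed

lemma finite_sumset: "finite (A + {0, m, b, b'})"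
  using finA by (intro finite_set_plus) auto

text \<open>
The largest element of the class, moved by \<open>m\<close>, is new.
\<close>
lemma card_class_double:
  assumes "fibre s > 0"
  shows "fibre s + 1 \<le> card {x \<in> A + {0, m, b, b'}. x mod m = s mod m}"
proof -
  let ?F = "{a \<in> A. a mod m = s mod m}"
  have F: "finite ?F" "?F \<noteq> {}" using assms finA by (auto simp: fibre_def card_gt_0_iff)
  let ?M = "Max ?F"
  have M: "?M \<in> ?F" using F by (intro Max_in)
  have "?M + m \<notin> ?F" using Max_ge[OF F(1), of "?M + m"] m_pos by force
  hence "fibre s + 1 = card (insert (?M + m) ?F)" using F(1) by (simp add: fibre_def)
  also have "\<dots> \<le> card {x \<in> A + {0, m, b, b'}. x mod m = s mod m}"
  proof (rule card_mono)
    show "finite {x \<in> A + {0, m, b, b'}. x mod m = s mod m}"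
      using finite_sumset[of b b'] by simp
    have "x \<in> A + {0, m, b, b'}" if "x \<in> A" for x
      using set_plus_intro[OF that, of 0 "{0, m, b, b'}"] by simp
    moreover have "?M + m \<in> A + {0, m, b, b'}"
      using M by (intro set_plus_intro) auto
    moreover have "(?M + m) mod m = s mod m" using M by simp
    ultimately show "insert (?M + m) ?F \<subseteq> {x \<in> A + {0, m, b, b'}. x mod m = s mod m}"
      by blast
  qed
  finally show ?thesis .
qed

text \<open>
Sort the sumset by residues. An occupied class gains an element from \<open>{0, m}\<close>; a vacant class \<open>s\<close>
receives a translate of the class \<open>s - b\<close> and one of the class \<open>s - b'\<close>, which may coincide.
\<close>
lemma card_sumset_ge:
  "n + num_occupied + (\<Sum>s\<in>vacant. max (fibre (s - b)) (fibre (s - b'))) \<le> card (A + {0, m, b, b'})"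
proof -
  let ?C = "A + {0, m, b, b'}"
  note finC = finite_sumset[of b b']
  let ?P = "{s \<in> {0..<m}. fibre s > 0}"
  have split: "{0..<m} = ?P \<union> vacant" "?P \<inter> vacant = {}" "finite vacant" by (auto simp: vacant_def)
  have n: "(\<Sum>s\<in>?P. fibre s) = n"
    by (subst sum_fibre [symmetric], rule sum.mono_neutral_left) auto
  have "n + num_occupied = (\<Sum>s\<in>?P. fibre s + 1)"
    unfolding sum.distrib n by (simp add: num_occupied_def occupied_def)
  also have "\<dots> \<le> (\<Sum>s\<in>?P. card {x \<in> ?C. x mod m = s})"
  proof (rule sum_mono)
    fix s assume "s \<in> ?P"
    thus "fibre s + 1 \<le> card {x \<in> ?C. x mod m = s}"
      using card_class_double[of s b b'] by simp
  qed
  finally have 1: "n + num_occupied \<le> (\<Sum>s\<in>?P. card {x \<in> ?C. x mod m = s})" .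
  have 2: "(\<Sum>s\<in>vacant. max (fibre (s - b)) (fibre (s - b'))) \<le> (\<Sum>s\<in>vacant. card {x \<in> ?C. x mod m = s})"
  proof (rule sum_mono)
    fix s assume "s \<in> vacant"
    hence s: "s mod m = s" by (auto simp: vacant_def)
    have "fibre (s - c) \<le> card {x \<in> ?C. x mod m = s}" if "c \<in> {b, b'}" for c
    proof -
      have "fibre (s - c) = card {x \<in> (\<lambda>a. a + c) ` A. x mod m = s mod m}"
        by (rule card_class_image [symmetric])
      also have "\<dots> \<le> card {x \<in> ?C. x mod m = s}"
        using finC that s by (intro card_mono) (auto intro: set_plus_intro)
      finally show ?thesis .
    qed
    thus "max (fibre (s - b)) (fibre (s - b')) \<le> card {x \<in> ?C. x mod m = s}" by auto
  qed
  have "card ?C = (\<Sum>s\<in>?P. card {x \<in> ?C. x mod m = s}) + (\<Sum>s\<in>vacant. card {x \<in> ?C. x mod m = s})"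
    unfolding card_sumset_classes[OF finC] by (subst split(1), rule sum.union_disjoint) (use split in auto)
  with 1 2 show ?thesis by linarith
qed

end


section \<open>Inflow into vacant residue classes\<close>

context shift_pair
begin

lemma card_occupied: "card occupied = num_occupied" by (simp add: num_occupied_def)

lemma vacant_alt: "vacant = {0..<m} - occupied" by (auto simp: vacant_def occupied_def)

lemma finite_vacant [simp]: "finite vacant" by (simp add: vacant_alt)

lemma occupied_sub: "occupied \<subseteq> {0..<m}" by (auto simp: occupied_def)

lemma inj_translate: "inj_on (\<lambda>b. (r + b) mod m) {0..<m}"
proof (rule inj_onI)
  fix x y assume "x \<in> {0..<m}" "y \<in> {0..<m}" "(r + x) mod m = (r + y) mod m"
  hence "((r + x) mod m - r) mod m = ((r + y) mod m - r) mod m" by simp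
  hence "x mod m = y mod m" by (simp add: mod_diff_left_eq)
  thus "x = y" using \<open>x \<in> {0..<m}\<close> \<open>y \<in> {0..<m}\<close> by simp
qed

lemma card_B0: "card (B - {m}) = n - 1" and finite_B0: "finite (B - {m})"
  and B0_sub: "B - {m} \<subseteq> {0..<m}"
  using cardB finB mB Bsub by (auto simp: order_le_less)

text \<open>
For a fixed element of \<open>A\<close>, the \<open>n - 1\<close> shifts in \<open>B - {m}\<close> lead to distinct residues,
at most \<open>card T\<close> of which lie in \<open>T\<close>.
\<close>
lemma weight_outside_average:
  assumes T: "T \<subseteq> {0..<m}"
  shows "real n * (real n - 1 - real (card T)) \<le>
    (\<Sum>b\<in>B - {m}. \<Sum>s\<in>{0..<m} - T. real (fibre (s - b)))"
proof -
  have finT: "finite T" using T finite_subset by blast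
  have 1: "(\<Sum>s\<in>{0..<m} - T. real (fibre (s - b))) =
      (\<Sum>r\<in>{0..<m}. real (fibre r) * of_bool ((r + b) mod m \<notin> T))" for b
  proof -
    let ?g = "\<lambda>r. real (fibre r) * of_bool ((r + b) mod m \<notin> T)"
    have "(\<Sum>s\<in>{0..<m} - T. real (fibre (s - b))) = (\<Sum>s\<in>{0..<m}. ?g (s + (- b)))"
      by (intro sum.mono_neutral_cong_left) auto
    also have "\<dots> = (\<Sum>s\<in>{0..<m}. ?g s)"
      by (rule sum_periodic_shift) (auto simp: m_pos mod_add_left_eq)
    finally show ?thesis .
  qed
  have 2: "real n - 1 - real (card T) \<le> (\<Sum>b\<in>B - {m}. of_bool ((r + b) mod m \<notin> T))" for r
  proof -
    have "card {b \<in> B - {m}. (r + b) mod m \<in> T} \<le> card T"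
      by (rule card_inj_on_le[OF _ _ finT, of "\<lambda>b. (r + b) mod m"])
        (use B0_sub inj_translate in \<open>auto intro: inj_on_subset\<close>)
    moreover have "card (B - {m}) = card {b \<in> B - {m}. (r + b) mod m \<in> T}
        + card {b \<in> B - {m}. (r + b) mod m \<notin> T}"
      by (subst card_Un_disjoint [symmetric]) (auto intro!: arg_cong[of _ _ card] finB)
    ultimately have "real n - 1 \<le> real (card T) + real (card {b \<in> B - {m}. (r + b) mod m \<notin> T})"
      using n2 card_B0 by linarith
    also have "{b \<in> B - {m}. (r + b) mod m \<notin> T} = (B - {m}) \<inter> {b. (r + b) mod m \<notin> T}" by auto
    finally show ?thesis using finite_B0 by (simp add: sum.If_cases of_bool_def Int_def)
  qed
  have "real n * (real n - 1 - real (card T)) = (\<Sum>r\<in>{0..<m}. real (fibre r) * (real n - 1 - real (card T)))"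
    by (simp add: sum_distrib_right [symmetric] sum_fibre flip: of_nat_sum)
  also have "\<dots> \<le> (\<Sum>r\<in>{0..<m}. real (fibre r) * (\<Sum>b\<in>B - {m}. of_bool ((r + b) mod m \<notin> T)))"
    using 2 by (intro sum_mono mult_left_mono) auto
  also have "\<dots> = (\<Sum>b\<in>B - {m}. \<Sum>r\<in>{0..<m}. real (fibre r) * of_bool ((r + b) mod m \<notin> T))"
    unfolding sum_distrib_left by (rule sum.swap)
  finally show ?thesis unfolding 1 .
qed

text \<open>
Equivalently, the number of elements of \<open>A + b\<close> in vacant classes.
\<close>
definition inflow :: "int \<Rightarrow> nat" where
  "inflow b = (\<Sum>s\<in>vacant. fibre (s - b))"

lemma max_inflow_le:
  assumes "b \<in> B" "b' \<in> B"
  shows "real (\<Sum>s\<in>vacant. max (fibre (s - b)) (fibre (s - b'))) \<le> real n - 1 - real num_occupied + e"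
proof -
  have "real (n + num_occupied + (\<Sum>s\<in>vacant. max (fibre (s - b)) (fibre (s - b')))) \<le> real (card (A + {0, m, b, b'}))"
    using card_sumset_ge of_nat_le_iff by blast
  thus ?thesis using four[OF assms] by simp
qed

lemma inflow_le: "b \<in> B \<Longrightarrow> real (inflow b) \<le> real n - 1 - real num_occupied + e"
  using max_inflow_le[of b b] by (simp add: inflow_def)

lemma sum_inflow_ge:
  "real n * (real n - 1 - real num_occupied) \<le> (\<Sum>b\<in>B - {m}. real (inflow b))"
  using weight_outside_average[OF occupied_sub] by (simp add: inflow_def vacant_alt card_occupied)

text \<open>
In other words, \<open>A + {0, m, b}\<close> has at least \<open>2 n - 1\<close> elements for some \<open>b\<close>: the
average inflow makes up for the vacant classes. In particular the hypothesis cannot hold with negative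
\<open>\<epsilon>\<close>.
\<close>
lemma e_nonneg: "e \<ge> 0"
proof (cases "num_occupied \<le> n - 1")
  case True
  have "real n * (real n - 1 - real num_occupied) \<le> (\<Sum>b\<in>B - {m}. real n - 1 - real num_occupied + e)"
    using sum_inflow_ge by (rule order_trans) (intro sum_mono inflow_le, auto)
  also have "\<dots> = (real n - 1) * (real n - 1 - real num_occupied + e)"
    using n2 card_B0 by (simp add: of_nat_diff)
  finally have "(real n - 1 - real num_occupied) \<le> (real n - 1) * e" by (simp add: algebra_simps)
  moreover have "real n - 1 - real num_occupied \<ge> 0" using True n2 by linarith
  ultimately have "(real n - 1) * e \<ge> 0" by linarith
  thus ?thesis using n2 by (simp add: zero_le_mult_iff)
next
  case False
  hence "real n \<le> real num_occupied" by simp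
  thus ?thesis using inflow_le[OF zeroB] of_nat_0_le_iff[of "inflow 0"] by linarith
qed

text \<open>
Take a shift \<open>c\<close> whose inflow is at least the average. Combining it with any other shift adds at most
\<open>e\<close>, so on average over \<open>b\<close> the distributions of the inflow of \<open>b\<close> and of
\<open>c\<close> over the vacant classes differ by at most \<open>3 e\<close>. The vacant classes that \<open>c\<close>
reaches number at least \<open>x - e\<close> with \<open>x = n - 1 - num_occupied\<close>, because otherwise too many
elements would land outside them; since the inflow of \<open>c\<close> is at most \<open>x + e\<close>, at least \<open>x - 3
e\<close> of these classes receive exactly one element. But a class \<open>s\<close> can receive exactly one element from at
most \<open>num_occupied\<close> of the \<open>n - 1\<close> shifts, as \<open>s - b\<close> must be occupied. So each of
these classes contributes at least \<open>x\<close> to the total difference.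
\<close>
lemma few_missing_residues:
  defines "x \<equiv> real n - 1 - real num_occupied"
  assumes x: "x > 3 * e"
  shows "x * (x - 3 * e) \<le> 3 * (real n - 1) * e"
proof -
  let ?B0 = "B - {m}"
  have x0: "x > 0" using x e_nonneg by linarith
  have p: "real (card ?B0) = real n - 1" using card_B0 n2 by (simp add: of_nat_diff)
  have p1: "real n - 1 \<ge> 1" using n2 by simp
  have ne: "?B0 \<noteq> {}"
  proof
    assume "?B0 = {}"
    hence "card ?B0 = 0" by (simp only: card.empty)
    with p p1 show False by simp
  qed
  have "\<exists>c\<in>?B0. real (inflow c) \<ge> x"
  proof (rule ccontr)
    assume "\<not> ?thesis"
    hence "(\<Sum>b\<in>?B0. real (inflow b)) < (\<Sum>b\<in>?B0. x)"
      using ne finite_B0 by (intro sum_strict_mono) (auto simp: not_le)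
    also have "\<dots> = (real n - 1) * x" using p by simp
    also have "\<dots> \<le> real n * x" using x0 by (simp add: algebra_simps)
    finally show False using sum_inflow_ge by (simp add: x_def)
  qed
  then obtain c where c: "c \<in> ?B0" "real (inflow c) \<ge> x" by blast
  \<comment> \<open>the truncated differences count what \<open>b\<close> adds to the inflow of \<open>c\<close>\<close>
  have excess: "(\<Sum>s\<in>vacant. real (fibre (s - b) - fibre (s - c))) \<le> e" if "b \<in> B" for b
  proof -
    have "(\<Sum>s\<in>vacant. real (fibre (s - b) - fibre (s - c))) + real (inflow c)
       = real (\<Sum>s\<in>vacant. max (fibre (s - b)) (fibre (s - c)))"
      unfolding inflow_def of_nat_sum sum.distrib [symmetric] by (intro sum.cong) auto
    thus ?thesis using max_inflow_le[OF that, of c] c x_def by auto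
  qed
  let ?S = "{s \<in> vacant. fibre (s - c) > 0}"
  let ?S1 = "{s \<in> vacant. fibre (s - c) = 1}"
  let ?T = "occupied \<union> ?S"
  have T: "?T \<subseteq> {0..<m}" by (auto simp: occupied_def vacant_def)
  have cardT: "real (card ?T) = real num_occupied + real (card ?S)"
  proof -
    have "card ?T = card occupied + card ?S"
      using occupied_sub by (intro card_Un_disjoint) (auto simp: vacant_alt intro: finite_subset)
    thus ?thesis by (simp add: card_occupied)
  qed
  \<comment> \<open>an element that some \<open>b\<close> brings outside \<open>?T\<close> is in excess of the inflow of \<open>c\<close>\<close>
  have S_ge: "real (card ?S) \<ge> x - e"
  proof -
    have "real n * (real n - 1 - real (card ?T)) \<le> (\<Sum>b\<in>?B0. \<Sum>s\<in>{0..<m} - ?T. real (fibre (s - b)))"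
      by (rule weight_outside_average[OF T])
    also have "\<dots> \<le> (\<Sum>b\<in>?B0. \<Sum>s\<in>vacant. real (fibre (s - b) - fibre (s - c)))"
    proof (rule sum_mono)
      fix b
      have "(\<Sum>s\<in>{0..<m} - ?T. real (fibre (s - b))) = (\<Sum>s\<in>{0..<m} - ?T. real (fibre (s - b) - fibre (s - c)))"
        by (rule sum.cong) (auto simp: vacant_alt)
      also have "\<dots> \<le> (\<Sum>s\<in>vacant. real (fibre (s - b) - fibre (s - c)))"
        by (rule sum_mono2) (auto simp: vacant_alt)
      finally show "(\<Sum>s\<in>{0..<m} - ?T. real (fibre (s - b))) \<le>
          (\<Sum>s\<in>vacant. real (fibre (s - b) - fibre (s - c)))" .
    qed
    also have "\<dots> \<le> (\<Sum>b\<in>?B0. e)" using excess by (intro sum_mono) auto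
    also have "\<dots> = (real n - 1) * e" using p by simp
    also have "\<dots> \<le> real n * e" using e_nonneg by (simp add: algebra_simps)
    finally have "real n * (real n - 1 - real (card ?T)) \<le> real n * e" .
    hence "real n - 1 - real (card ?T) \<le> e" using n2 by (simp add: mult_le_cancel_left)
    thus ?thesis unfolding cardT x_def by simp
  qed
  have S1_ge: "real (card ?S1) \<ge> x - 3 * e"
  proof -
    have "2 * real (card ?S) - real (card ?S1) = (\<Sum>s\<in>?S. 2 - of_bool (fibre (s - c) = 1))"
    proof -
      have "(\<Sum>s\<in>?S. of_bool (fibre (s - c) = 1)) = real (card (?S \<inter> {s. fibre (s - c) = 1}))"
        by (simp add: sum.If_cases of_bool_def)
      also have "?S \<inter> {s. fibre (s - c) = 1} = ?S1" by auto
      finally show ?thesis by (simp add: sum_subtractf)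
    qed
    also have "\<dots> \<le> (\<Sum>s\<in>?S. real (fibre (s - c)))"
      by (intro sum_mono) (auto simp: of_bool_def)
    also have "\<dots> \<le> real (inflow c)"
      unfolding inflow_def of_nat_sum by (intro sum_mono2) auto
    also have "\<dots> \<le> x + e" using inflow_le c x_def by auto
    finally show ?thesis using S_ge by linarith
  qed
  have dev: "(\<Sum>b\<in>?B0. \<Sum>s\<in>vacant. \<bar>real (fibre (s - b)) - real (fibre (s - c))\<bar>) \<le> 3 * (real n - 1) * e"
  proof -
    have "(\<Sum>s\<in>vacant. \<bar>real (fibre (s - b)) - real (fibre (s - c))\<bar>) \<le> (3 * e + x) - real (inflow b)"
      if "b \<in> B" for b
    proof -
      have "(\<Sum>s\<in>vacant. \<bar>real (fibre (s - b)) - real (fibre (s - c))\<bar>) + real (inflow b)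
         = 2 * (\<Sum>s\<in>vacant. real (fibre (s - b) - fibre (s - c))) + real (inflow c)"
        unfolding inflow_def of_nat_sum sum.distrib [symmetric] sum_distrib_left
        by (intro sum.cong) (auto simp: abs_if split: nat_diff_split)
      thus ?thesis using excess[OF that] inflow_le[of c] c x_def by auto
    qed
    hence "(\<Sum>b\<in>?B0. \<Sum>s\<in>vacant. \<bar>real (fibre (s - b)) - real (fibre (s - c))\<bar>)
       \<le> (\<Sum>b\<in>?B0. (3 * e + x) - real (inflow b))"
      by (intro sum_mono) auto
    also have "\<dots> = (real n - 1) * (3 * e + x) - (\<Sum>b\<in>?B0. real (inflow b))"
      by (simp add: sum_subtractf p)
    also have "\<dots> \<le> (real n - 1) * (3 * e + x) - real n * x"
      using sum_inflow_ge by (simp add: x_def)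
    also have "\<dots> \<le> 3 * (real n - 1) * e" using x0 by (simp add: algebra_simps)
    finally show ?thesis .
  qed
  have "real (card ?S1) * (real n - 1 - real num_occupied) \<le> 3 * (real n - 1) * e"
  proof -
    have "real n - 1 - real num_occupied \<le> (\<Sum>b\<in>?B0. \<bar>real (fibre (s - b)) - real (fibre (s - c))\<bar>)"
      if s: "s \<in> ?S1" for s
    proof -
      have "card {b \<in> ?B0. fibre (s - b) = 1} \<le> card occupied"
      proof (rule card_inj_on_le)
        show "inj_on (\<lambda>b. (s - b) mod m) {b \<in> ?B0. fibre (s - b) = 1}"
        proof (rule inj_onI)
          fix y z assume yz: "y \<in> {b \<in> ?B0. fibre (s - b) = 1}" "z \<in> {b \<in> ?B0. fibre (s - b) = 1}"
            and eq: "(s - y) mod m = (s - z) mod m"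
          have "(s - (s - y) mod m) mod m = (s - (s - z) mod m) mod m" by (simp add: eq)
          hence "y mod m = z mod m" by (simp add: mod_diff_right_eq)
          moreover have "y \<in> {0..<m}" "z \<in> {0..<m}" using yz B0_sub by blast+
          ultimately show "y = z" by simp
        qed
        show "(\<lambda>b. (s - b) mod m) ` {b \<in> ?B0. fibre (s - b) = 1} \<subseteq> occupied"
          using m_pos by (auto simp: occupied_def)
        show "finite occupied" using occupied_sub finite_subset by blast
      qed
      hence le: "real (card {b \<in> ?B0. fibre (s - b) = 1}) \<le> real num_occupied" by (simp add: card_occupied)
      have "real n - 1 = real (card {b \<in> ?B0. fibre (s - b) = 1}) + real (card {b \<in> ?B0. fibre (s - b) \<noteq> 1})"
        unfolding p [symmetric] of_nat_add [symmetric]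
        by (subst card_Un_disjoint [symmetric]) (auto intro!: arg_cong[of _ _ card] finB)
      also have "card {b \<in> ?B0. fibre (s - b) \<noteq> 1} = card (?B0 \<inter> {b. fibre (s - b) \<noteq> 1})"
        by (intro arg_cong[of _ _ card]) auto
      also have "real \<dots> = (\<Sum>b\<in>?B0. of_bool (fibre (s - b) \<noteq> 1))"
        using finB by (simp add: sum.If_cases of_bool_def)
      also have "\<dots> \<le> (\<Sum>b\<in>?B0. \<bar>real (fibre (s - b)) - real (fibre (s - c))\<bar>)"
        using s by (intro sum_mono) (auto simp: of_bool_def)
      finally show ?thesis using le by linarith
    qed
    hence "(\<Sum>s\<in>?S1. real n - 1 - real num_occupied) \<le>
        (\<Sum>s\<in>?S1. \<Sum>b\<in>?B0. \<bar>real (fibre (s - b)) - real (fibre (s - c))\<bar>)"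
      by (rule sum_mono)
    also have "\<dots> \<le> (\<Sum>s\<in>vacant. \<Sum>b\<in>?B0. \<bar>real (fibre (s - b)) - real (fibre (s - c))\<bar>)"
    proof (rule sum_mono2[OF finite_vacant])
      show "?S1 \<subseteq> vacant" by blast
    qed (rule sum_nonneg, rule abs_ge_zero)
    also have "\<dots> = (\<Sum>b\<in>?B0. \<Sum>s\<in>vacant. \<bar>real (fibre (s - b)) - real (fibre (s - c))\<bar>)"
      by (rule sum.swap)
    finally show ?thesis using dev by simp
  qed
  moreover have "x * (x - 3 * e) \<le> real (card ?S1) * (real n - 1 - real num_occupied)"
    using S1_ge x0 by (simp add: x_def mult.commute[of "real n - 1 - real num_occupied"] mult_right_mono)
  ultimately show ?thesis by linarith
qed

end


section \<open>Almost-periods and the size of the modulus\<close>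

text \<open>
The least positive element of a nontrivial subgroup of the integers divides all its elements.
\<close>
lemma subgroup_of_int_eq_UNIV:
  fixes K B :: "int set"
  assumes zero: "0 \<in> K" and diff: "\<And>x y. x \<in> K \<Longrightarrow> y \<in> K \<Longrightarrow> x - y \<in> K"
    and sub: "B \<subseteq> K" and gcd: "Gcd B = 1"
  shows "K = UNIV"
proof -
  have neg: "- x \<in> K" if "x \<in> K" for x using diff[OF zero that] by simp
  have add: "x + y \<in> K" if "x \<in> K" "y \<in> K" for x y
    using diff[OF that(1) neg[OF that(2)]] by simp
  have nat_mult: "int i * x \<in> K" if "x \<in> K" for i x
    by (induction i) (auto simp: zero algebra_simps intro: add that)
  have mult: "z * x \<in> K" if "x \<in> K" for z x
  proof (cases "z \<ge> 0")
    case True thus ?thesis using nat_mult[OF that, of "nat z"] by simp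
  next
    case False thus ?thesis using neg[OF nat_mult[OF that, of "nat (-z)"]] by simp
  qed
  have "\<exists>x\<in>B. x \<noteq> 0"
  proof (rule ccontr)
    assume "\<not> ?thesis"
    hence "\<forall>x\<in>B. 0 dvd x" by auto
    hence "(0::int) dvd Gcd B" by (intro Gcd_greatest) auto
    thus False using gcd by simp
  qed
  then obtain x where x: "x \<in> K" "x \<noteq> 0" using sub by auto
  have "int (nat \<bar>x\<bar>) \<in> K" using x(1) neg[OF x(1)] by (cases "x \<ge> 0") simp_all
  hence ex: "\<exists>i. i > 0 \<and> int i \<in> K"
    using x(2) by (intro exI[of _ "nat \<bar>x\<bar>"]) simp
  define g where "g = (LEAST i. i > 0 \<and> int i \<in> K)"
  have "g > 0 \<and> int g \<in> K" unfolding g_def by (rule LeastI_ex[OF ex])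
  note g = this[THEN conjunct1] this[THEN conjunct2]
  have "int g dvd x" if "x \<in> K" for x
  proof (rule ccontr)
    assume "\<not> int g dvd x"
    hence "x mod int g \<noteq> 0" by (simp add: mod_eq_0_iff_dvd)
    moreover have "x mod int g \<ge> 0" using g by simp
    ultimately have pos: "x mod int g > 0" by linarith
    have "x mod int g = x - (x div int g) * int g" by (simp add: minus_div_mult_eq_mod)
    hence "x mod int g \<in> K" using diff[OF that mult[OF g(2), of "x div int g"]] by simp
    hence "nat (x mod int g) > 0 \<and> int (nat (x mod int g)) \<in> K" using pos by simp
    hence "g \<le> nat (x mod int g)" unfolding g_def by (rule Least_le)
    moreover have "x mod int g < int g" using g by simp
    ultimately show False using pos by linarith
  qed
  hence "int g dvd Gcd B" using sub by (intro Gcd_greatest) auto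
  hence "1 \<in> K" using g gcd by simp
  thus ?thesis using mult[of 1] by auto
qed

context shift_pair
begin

text \<open>
The measure of failure of \<open>x\<close> to be a period of the set of occupied residues. It is subadditive and even, like
the distance of a set from its translate.
\<close>
definition escape :: "int \<Rightarrow> nat" where
  "escape x = card {r \<in> occupied. fibre (r + x) = 0}"

lemma finite_occupied [simp]: "finite occupied" using occupied_sub finite_subset by blast

lemma fibre_add_mod [simp]: "fibre (x + y mod m) = fibre (x + y)"
  by (metis mod_add_right_eq fibre_mod)

lemma shift_mod_inj: "inj_on (\<lambda>r. (r + x) mod m) occupied"
  using inj_on_subset[OF inj_translate[of x] occupied_sub] by (simp add: add.commute)

lemma overlap_escape: "card {r \<in> occupied. fibre (r + x) > 0} + escape x = num_occupied"
proof -
  have "card {r \<in> occupied. fibre (r + x) > 0} + escape x = card ({r \<in> occupied. fibre (r + x) > 0} \<union> {r \<in> occupied. fibre (r + x) = 0})"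
    unfolding escape_def by (intro card_Un_disjoint [symmetric]) auto
  also have "{r \<in> occupied. fibre (r + x) > 0} \<union> {r \<in> occupied. fibre (r + x) = 0} = occupied" by auto
  finally show ?thesis by (simp add: card_occupied)
qed

lemma escape_add: "escape (x + y) \<le> escape x + escape y"
proof -
  have "{r \<in> occupied. fibre (r + (x + y)) = 0} \<subseteq>
      {r \<in> occupied. fibre (r + x) = 0} \<union> {r \<in> occupied. fibre (r + x) > 0 \<and> fibre (r + x + y) = 0}"
    by (auto simp: add.assoc)
  hence "escape (x + y) \<le> card ({r \<in> occupied. fibre (r + x) = 0} \<union> {r \<in> occupied. fibre (r + x) > 0 \<and> fibre (r + x + y) = 0})"
    unfolding escape_def by (intro card_mono) auto
  also have "\<dots> \<le> escape x + card {r \<in> occupied. fibre (r + x) > 0 \<and> fibre (r + x + y) = 0}"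
    unfolding escape_def by (rule card_Un_le)
  also have "card {r \<in> occupied. fibre (r + x) > 0 \<and> fibre (r + x + y) = 0} \<le> escape y"
    unfolding escape_def
  proof (rule card_inj_on_le)
    show "inj_on (\<lambda>r. (r + x) mod m) {r \<in> occupied. fibre (r + x) > 0 \<and> fibre (r + x + y) = 0}"
      by (rule inj_on_subset[OF shift_mod_inj]) auto
    show "(\<lambda>r. (r + x) mod m) ` {r \<in> occupied. fibre (r + x) > 0 \<and> fibre (r + x + y) = 0} \<subseteq> {r \<in> occupied. fibre (r + y) = 0}"
      using m_pos by (auto simp: occupied_def)
  qed auto
  finally show ?thesis by simp
qed

lemma escape_neg_le: "escape (- x) \<le> escape x"
proof -
  have "card {r \<in> occupied. fibre (r + x) > 0} \<le> card {r \<in> occupied. fibre (r + (- x)) > 0}"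
  proof (rule card_inj_on_le)
    show "inj_on (\<lambda>r. (r + x) mod m) {r \<in> occupied. fibre (r + x) > 0}"
      by (rule inj_on_subset[OF shift_mod_inj]) auto
    show "(\<lambda>r. (r + x) mod m) ` {r \<in> occupied. fibre (r + x) > 0} \<subseteq> {r \<in> occupied. fibre (r + (- x)) > 0}"
      using m_pos by (auto simp: occupied_def)
  qed auto
  thus ?thesis using overlap_escape[of x] overlap_escape[of "-x"] by linarith
qed

lemma escape_mod: "escape (x mod m) = escape x"
  by (simp add: escape_def)

lemma escape_cong: "x mod m = y mod m \<Longrightarrow> escape x = escape y"
  by (metis escape_mod)

text \<open>
Every occupied class that escapes under the shift \<open>b\<close> contributes to the inflow of \<open>b\<close>.
\<close>
lemma escape_le:
  assumes "b \<in> B"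
  shows "real (escape b) \<le> real n - 1 - real num_occupied + e"
proof -
  have "escape b \<le> card {s \<in> vacant. fibre (s - b) > 0}"
    unfolding escape_def
  proof (rule card_inj_on_le)
    show "inj_on (\<lambda>r. (r + b) mod m) {r \<in> occupied. fibre (r + b) = 0}"
      by (rule inj_on_subset[OF shift_mod_inj]) auto
    show "(\<lambda>r. (r + b) mod m) ` {r \<in> occupied. fibre (r + b) = 0} \<subseteq> {s \<in> vacant. fibre (s - b) > 0}"
      using m_pos by (auto simp: occupied_def vacant_def)
  qed auto
  also have "\<dots> \<le> (\<Sum>s\<in>{s \<in> vacant. fibre (s - b) > 0}. fibre (s - b))"
    by (subst card_eq_sum) (intro sum_mono, auto)
  also have "\<dots> \<le> inflow b"
    unfolding inflow_def by (intro sum_mono2) auto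
  finally have "real (escape b) \<le> real (inflow b)" by simp
  thus ?thesis using inflow_le[OF assms] by linarith
qed

text \<open>
Summed over all \<open>x\<close>, the overlap of the occupied set with its translate by \<open>x\<close> is
\<open>num_occupied\<^sup>2\<close>, and each almost-period accounts for nearly \<open>num_occupied\<close> of it.
\<close>
lemma card_almost_periods:
  assumes D: "D \<subseteq> {0..<m}" and le: "\<And>x. x \<in> D \<Longrightarrow> real (escape x) \<le> \<theta>"
  shows "real (card D) * (real num_occupied - \<theta>) \<le> (real num_occupied)\<^sup>2"
proof -
  have "real (card D) * (real num_occupied - \<theta>) = (\<Sum>x\<in>D. real num_occupied - \<theta>)" by simp
  also have "\<dots> \<le> (\<Sum>x\<in>D. real (card {r \<in> occupied. fibre (r + x) > 0}))"
  proof (rule sum_mono)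
    fix x assume "x \<in> D"
    thus "real num_occupied - \<theta> \<le> real (card {r \<in> occupied. fibre (r + x) > 0})"
      using le[of x] overlap_escape[of x] by linarith
  qed
  also have "\<dots> \<le> (\<Sum>x\<in>{0..<m}. real (card {r \<in> occupied. fibre (r + x) > 0}))"
    using D by (intro sum_mono2) auto
  also have "\<dots> = real (\<Sum>x\<in>{0..<m}. card {r \<in> occupied. fibre (r + x) > 0})" by simp
  also have "(\<Sum>x\<in>{0..<m}. card {r \<in> occupied. fibre (r + x) > 0}) = (\<Sum>r\<in>occupied. card {x \<in> {0..<m}. fibre (r + x) > 0})"
    by (rule sum_multicount_gen) auto
  also have "\<dots> = (\<Sum>r\<in>occupied. num_occupied)"
  proof (rule sum.cong)
    fix r
    have eq: "card {x \<in> {0..<m}. fibre (x + c) > 0} = (\<Sum>x\<in>{0..<m}. of_bool (fibre (x + c) > 0))" for c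
      by (simp add: sum.If_cases of_bool_def Int_def)
    have "card {x \<in> {0..<m}. fibre (r + x) > 0} = card {x \<in> {0..<m}. fibre (x + r) > 0}"
      by (simp add: add.commute)
    also have "\<dots> = (\<Sum>x\<in>{0..<m}. of_bool (fibre (x + 0) > 0))"
      unfolding eq by (subst sum_periodic_shift[OF m_pos]) auto
    also have "\<dots> = num_occupied" unfolding eq [symmetric] by (simp add: num_occupied_def occupied_def)
    finally show "card {x \<in> {0..<m}. fibre (r + x) > 0} = num_occupied" .
  qed simp
  also have "real \<dots> = (real num_occupied)\<^sup>2" by (simp add: card_occupied power2_eq_square)
  finally show ?thesis .
qed

text \<open>
Let \<open>K\<close> be the set of differences of \<open>B\<close> modulo \<open>m\<close>. The translates of
\<open>B\<close> by two of its elements both lie in the set of almost-periods, which has fewer than \<open>3/2 (n -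
1)\<close> elements, so they share more than half of their elements. Hence every element of \<open>K\<close> is a difference
of \<open>B\<close> in more than \<open>(n - 1)/2\<close> ways. For two elements of \<open>K\<close> such representations
have a common starting point, so that their difference is again in \<open>K\<close>. As \<open>Gcd B = 1\<close>, the
subgroup \<open>K\<close> is everything, and all residues are almost-periods.
\<close>
lemma modulus_bound:
  defines "L \<equiv> real n - 1 - real num_occupied + e"
  assumes gcd: "Gcd B = 1" and small: "2 * (real num_occupied)\<^sup>2 < 3 * (real n - 1) * (real num_occupied - 2 * L)"
  shows "real_of_int m * (real num_occupied - 2 * L) \<le> (real num_occupied)\<^sup>2"
proof -
  let ?B0 = "B - {m}"
  have zero0: "0 \<in> ?B0" using zeroB m_pos by auto
  define K where "K = {x. \<exists>b1\<in>?B0. \<exists>b2\<in>?B0. x mod m = (b1 - b2) mod m}"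
  define Rep where "Rep x = {\<beta> \<in> ?B0. (\<beta> + x) mod m \<in> ?B0}" for x
  have p: "real (card ?B0) = real n - 1" using card_B0 n2 by (simp add: of_nat_diff)
  have p1: "real n - 1 \<ge> 1" using n2 by simp
  have pos: "real num_occupied - 2 * L > 0"
  proof (rule ccontr)
    assume "\<not> ?thesis"
    hence "3 * (real n - 1) * (real num_occupied - 2 * L) \<le> 0" using p1 by (intro mult_nonneg_nonpos) auto
    thus False using small zero_le_power2[of "real num_occupied"] by linarith
  qed
  have escape2: "real (escape (b + b')) \<le> 2 * L" if "b \<in> B" "b' \<in> B" for b b'
    using of_nat_mono[OF escape_add[of b b'], where 'a = real] escape_le[OF that(1)]
      escape_le[OF that(2)] unfolding L_def by simp
  let ?D = "{x \<in> {0..<m}. real (escape x) \<le> 2 * L}"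
  have "real (card ?D) * (real num_occupied - 2 * L) \<le> (real num_occupied)\<^sup>2"
    by (rule card_almost_periods) auto
  also have "\<dots> < (3 / 2 * (real n - 1)) * (real num_occupied - 2 * L)" using small by simp
  finally have cardD: "real (card ?D) < 3 / 2 * (real n - 1)"
    using pos by (simp add: mult_less_cancel_right)
  \<comment> \<open>\<open>Rep x\<close> collects the starting points of representations of \<open>x\<close> as a difference\<close>
  have Rep_big: "2 * real (card (Rep x)) > real n - 1" if xK: "x \<in> K" for x
  proof -
    obtain b1 b2 where b: "b1 \<in> ?B0" "b2 \<in> ?B0" "x mod m = (b1 - b2) mod m"
      using xK unfolding K_def by blast
    let ?S = "\<lambda>b. (\<lambda>\<beta>. (b + \<beta>) mod m) ` ?B0"
    have S: "?S b \<subseteq> ?D" "real (card (?S b)) = real n - 1" if "b \<in> ?B0" for b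
    proof -
      show "?S b \<subseteq> ?D" using that escape2 m_pos by (auto simp: escape_mod)
      have "card (?S b) = card ?B0"
        by (rule card_image) (rule inj_on_subset[OF inj_translate B0_sub])
      thus "real (card (?S b)) = real n - 1" using p by simp
    qed
    have fin: "finite (?S b)" for b using finB by simp
    have "real (card (?S b1 \<union> ?S b2)) \<le> real (card ?D)"
      using S(1)[OF b(1)] S(1)[OF b(2)] by (intro of_nat_mono card_mono) auto
    moreover have "card (?S b1) + card (?S b2) = card (?S b1 \<union> ?S b2) + card (?S b1 \<inter> ?S b2)"
      by (rule card_Un_Int[OF fin fin])
    hence "real (card (?S b1)) + real (card (?S b2)) = real (card (?S b1 \<union> ?S b2)) + real (card (?S b1 \<inter> ?S b2))"
      by (simp only: of_nat_add [symmetric])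
    moreover have "q < 2 * i"
      if "u \<le> d" "a + b = u + i" "d < 3 / 2 * q" "a = q" "b = q" for a b u i d q :: real
      using that by linarith
    ultimately have "real n - 1 < 2 * real (card (?S b1 \<inter> ?S b2))"
      using cardD S(2)[OF b(1)] S(2)[OF b(2)] by blast
    also have "card (?S b1 \<inter> ?S b2) \<le> card (Rep x)"
    proof (rule card_inj_on_le)
      show "inj_on (\<lambda>y. (- b1 + y) mod m) (?S b1 \<inter> ?S b2)"
        using m_pos by (intro inj_on_subset[OF inj_translate]) auto
      show "(\<lambda>y. (- b1 + y) mod m) ` (?S b1 \<inter> ?S b2) \<subseteq> Rep x"
      proof (rule image_subsetI)
        fix y assume y: "y \<in> ?S b1 \<inter> ?S b2"
        obtain \<beta>1 where \<beta>1: "\<beta>1 \<in> ?B0" "y = (b1 + \<beta>1) mod m" using y by blast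
        obtain \<beta>2 where \<beta>2: "\<beta>2 \<in> ?B0" "y = (b2 + \<beta>2) mod m" using y by blast
        note \<beta> = \<beta>1(1) \<beta>2(1) \<beta>1(2) \<beta>2(2)
        have red: "\<beta>1 mod m = \<beta>1" "\<beta>2 mod m = \<beta>2" using \<beta> B0_sub by force+
        have 1: "(- b1 + y) mod m = \<beta>1"
          using red by (simp add: \<beta>(3) mod_diff_left_eq)
        have "(\<beta>1 + x) mod m = (\<beta>1 + (b1 - b2)) mod m"
          using b(3) by (metis mod_add_right_eq)
        also have "\<dots> = ((b1 + \<beta>1) mod m - b2) mod m"
          by (simp add: mod_diff_left_eq algebra_simps)
        also have "\<dots> = ((b2 + \<beta>2) mod m - b2) mod m" using \<beta> by simp
        also have "\<dots> = \<beta>2" using red by (simp add: mod_diff_left_eq)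
        finally show "(- b1 + y) mod m \<in> Rep x" using 1 \<beta> by (simp add: Rep_def)
      qed
      show "finite (Rep x)" using finB by (simp add: Rep_def)
    qed
    finally show ?thesis by simp
  qed
  have "K = UNIV"
  proof (rule subgroup_of_int_eq_UNIV[OF _ _ _ gcd])
    show "0 \<in> K" using zero0 by (force simp: K_def)
    show "B \<subseteq> K"
    proof
      fix b assume b: "b \<in> B"
      show "b \<in> K"
      proof (cases "b = m")
        case True
        thus ?thesis using zero0 unfolding K_def by (auto intro!: bexI[of _ 0])
      next
        case False
        hence "b \<in> ?B0" "b mod m = (b - 0) mod m" using b by auto
        thus ?thesis using zero0 unfolding K_def by blast
      qed
    qed
    fix x y assume xy: "x \<in> K" "y \<in> K"
    have "Rep x \<inter> Rep y \<noteq> {}"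
    proof
      assume "Rep x \<inter> Rep y = {}"
      hence "card (Rep x) + card (Rep y) = card (Rep x \<union> Rep y)"
        using finB by (intro card_Un_disjoint [symmetric]) (auto simp: Rep_def)
      also have "\<dots> \<le> card ?B0" using finB by (intro card_mono) (auto simp: Rep_def)
      finally have "real (card (Rep x)) + real (card (Rep y)) \<le> real n - 1"
        unfolding p [symmetric] by (metis of_nat_add of_nat_le_iff)
      thus False using Rep_big[OF xy(1)] Rep_big[OF xy(2)] by linarith
    qed
    then obtain \<beta> where "\<beta> \<in> Rep x" "\<beta> \<in> Rep y" by auto
    hence \<beta>: "(\<beta> + x) mod m \<in> ?B0" "(\<beta> + y) mod m \<in> ?B0" by (auto simp: Rep_def)
    have "(x - y) mod m = ((\<beta> + x) mod m - (\<beta> + y) mod m) mod m"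
      by (simp add: mod_diff_eq)
    thus "x - y \<in> K" unfolding K_def using \<beta> by blast
  qed
  have "real (escape x) \<le> 2 * L" for x
  proof -
    have "x \<in> K" using \<open>K = UNIV\<close> by simp
    then obtain b1 b2 where b: "b1 \<in> B" "b2 \<in> B" "x mod m = (b1 - b2) mod m"
      by (auto simp: K_def)
    have "escape x = escape (b1 + (- b2))" using escape_cong[OF b(3)] by simp
    also have "\<dots> \<le> escape b1 + escape b2"
      using escape_add[of b1 "- b2"] escape_neg_le[of b2] by linarith
    finally have "real (escape x) \<le> real (escape b1) + real (escape b2)" by linarith
    thus ?thesis using escape_le[OF b(1)] escape_le[OF b(2)] unfolding L_def by simp
  qed
  hence "real (card {0..<m}) * (real num_occupied - 2 * L) \<le> (real num_occupied)\<^sup>2"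
    by (intro card_almost_periods) auto
  thus ?thesis using m_pos by simp
qed

text \<open>
The lemmas \<open>few_missing_residues\<close> and \<open>modulus_bound\<close> with numerical values. The constants are
dictated by \<open>crude_stability\<close>, which needs deviations of order \<open>1 / 10 ^ 10\<close>;
\<open>few_missing_residues\<close> loses a square root, which is why \<open>e\<close> must be as small as \<open>n / 10 ^
22\<close>.
\<close>
lemma near_extremal_modulus:
  assumes gcd: "Gcd B = 1" and e_small: "e \<le> (real n - 1) * (2 / 10 ^ 22)"
  shows "real n - 1 - real num_occupied \<le> (real n - 1) * (5 / 10 ^ 11)"
    and "real_of_int m \<le> (real n - 1) * (1 + 4 / 10 ^ 10)"
proof -
  define p where "p = real n - 1"
  have p1: "p \<ge> 1" using n2 by (simp add: p_def)
  have e: "e \<le> p * (1 / 5000000000000000000000)" using e_small by (simp add: p_def)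
  define x where "x = p - real num_occupied"
  show "real n - 1 - real num_occupied \<le> (real n - 1) * (5 / 10 ^ 11)"
  proof (rule ccontr)
    assume "\<not> ?thesis"
    hence x: "x > p * (1 / 20000000000)" by (simp add: x_def p_def)
    have x3: "x - 3 * e \<ge> p * (1 / 25000000000)" using x e p1 by linarith
    have "p * (1 / 20000000000) * (p * (1 / 25000000000)) \<le> x * (x - 3 * e)"
      using x x3 p1 by (intro mult_mono) auto
    also have "\<dots> \<le> 3 * p * e"
      using few_missing_residues x3 p1 unfolding x_def p_def by auto
    also have "\<dots> \<le> 3 * p * (p * (1 / 5000000000000000000000))" using e p1 by (intro mult_left_mono) auto
    finally have "p * p \<le> 0" by (simp add: field_simps)
    thus False using p1 by (simp add: mult_le_0_iff)
  qed
  hence x_le: "x \<le> p * (1 / 20000000000)" by (simp add: x_def p_def)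
  have k_le: "real num_occupied \<le> p + e"
    using inflow_le[OF zeroB] of_nat_0_le_iff[of "inflow 0"] unfolding p_def by linarith
  have k_ge: "real num_occupied - 2 * (x + e) \<ge> p * (1 - 1 / 5000000000)"
  proof -
    have "real num_occupied - 2 * (x + e) \<ge> p - p / 5000000000"
      using x_le e p1 unfolding x_def by simp
    thus ?thesis by (simp add: right_diff_distrib)
  qed
  have k_sq: "(real num_occupied)\<^sup>2 \<le> p * p * (1 + 1 / 100000000000)"
  proof -
    have "real num_occupied \<le> p * (1 + 1 / 1000000000000)" using k_le e p1 by (simp add: algebra_simps)
    hence "real num_occupied * real num_occupied \<le> (p * (1 + 1 / 1000000000000)) * (p * (1 + 1 / 1000000000000))"
      using p1 by (intro mult_mono) auto
    also have "\<dots> = p * p * ((1 + 1 / 1000000000000) * (1 + 1 / 1000000000000))" by simp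
    also have "\<dots> \<le> p * p * (1 + 1 / 100000000000)" using p1 by (intro mult_left_mono) auto
    finally show ?thesis by (simp add: power2_eq_square)
  qed
  have pp: "p * p > 0" using p1 by simp
  have "2 * (real num_occupied)\<^sup>2 < 3 * p * (p * (1 - 1 / 5000000000))"
  proof -
    have "2 * (real num_occupied)\<^sup>2 \<le> p * p * (2 * (1 + 1 / 100000000000))" using k_sq by simp
    also have "\<dots> < p * p * (3 * (1 - 1 / 5000000000))" using pp by (intro mult_strict_left_mono) auto
    finally show ?thesis by simp
  qed
  also have "\<dots> \<le> 3 * p * (real num_occupied - 2 * (x + e))" using k_ge p1 by (intro mult_left_mono) auto
  finally have "2 * (real num_occupied)\<^sup>2 < 3 * (real n - 1) * (real num_occupied - 2 * (real n - 1 - real num_occupied + e))"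
    by (simp add: p_def x_def)
  from modulus_bound[OF gcd this]
  have "real_of_int m * (real num_occupied - 2 * (x + e)) \<le> (real num_occupied)\<^sup>2" by (simp add: p_def x_def)
  moreover have "real_of_int m * (p * (1 - 1 / 5000000000)) \<le> real_of_int m * (real num_occupied - 2 * (x + e))"
    using m_pos by (intro mult_left_mono[OF k_ge]) simp
  ultimately have "real_of_int m * (p * (1 - 1 / 5000000000)) \<le> p * p * (1 + 1 / 100000000000)"
    using k_sq by linarith
  also have "\<dots> \<le> p * p * ((1 + 1 / 2500000000) * (1 - 1 / 5000000000))"
    using pp by (intro mult_left_mono) auto
  finally have "real_of_int m * (p * (1 - 1 / 5000000000)) \<le> (p * (1 + 1 / 2500000000)) * (p * (1 - 1 / 5000000000))"
    by simp
  moreover have "p * (1 - 1 / 5000000000) > 0" using p1 by simp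
  ultimately have "real_of_int m \<le> p * (1 + 1 / 2500000000)" using mult_le_cancel_right_pos by blast
  thus "real_of_int m \<le> (real n - 1) * (1 + 4 / 10 ^ 10)" by (simp add: p_def)
qed

end


section \<open>Inversions of a set of integers\<close>

lemma card_Sigma_eq_sum:
  assumes "finite P" "\<And>s b. (s, b) \<in> P \<Longrightarrow> b \<in> I" "finite I"
  shows "card P = (\<Sum>b\<in>I. card {s. (s, b) \<in> P})"
proof -
  have fin: "finite {s. (s, b) \<in> P}" for b
    by (rule finite_subset[of _ "fst ` P"]) (use assms(1) in force)+
  have "P = (\<lambda>(b, s). (s, b)) ` (SIGMA b:I. {s. (s, b) \<in> P})"
    using assms(2) by force
  also have "card \<dots> = card (SIGMA b:I. {s. (s, b) \<in> P})"
    by (rule card_image) (auto simp: inj_on_def)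
  also have "\<dots> = (\<Sum>b\<in>I. card {s. (s, b) \<in> P})"
    using assms(3) fin by (intro card_SigmaI) auto
  finally show ?thesis .
qed

text \<open>
Let \<open>t\<close> be the left end that an interval with right end \<open>mid\<close> would have if it had as many elements
as \<open>A\<close> has below \<open>mid\<close>; \<open>u\<close> counts the elements of \<open>A\<close> below
\<open>t\<close>, and equally the gaps from \<open>t\<close> on. An inversion for the shift \<open>b\<close> is an element of
\<open>A\<close> that moves to a non-element below \<open>mid\<close>. If all shifts in \<open>S\<close> have few inversions,
then \<open>u\<close> is small: the shifts of length at most \<open>8 u\<close> have at least \<open>u\<^sup>2/4\<close>
inversions in total. If half of the gaps, or half of the stray elements, are at distance \<open>4 u\<close> or more from
\<open>t\<close>, then each of them forms inversions with most shifts of length up to \<open>4 u\<close>, because only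
\<open>u\<close> of the places reached are exceptional. Otherwise half of the stray elements and half of the gaps are near
\<open>t\<close>, and each pair of them is an inversion. The length scale has to be proportional to \<open>u\<close>: for
typical shifts of length \<open>n\<close>, disorder confined to a stretch of length \<open>u\<close> around \<open>t\<close>
is almost invisible.
\<close>
lemma few_inversions_left:
  fixes A S :: "int set" and mid :: int and \<tau> :: real and q :: nat
  assumes finA: "finite A"
  defines "t \<equiv> mid - int (card (A \<inter> {..<mid}))"
  defines "u \<equiv> card (A \<inter> {..<t})"
  assumes S: "card ({1..8 * int u} - S) \<le> q"
    and inv: "\<And>b. b \<in> S \<Longrightarrow> real (card {s. s < mid \<and> s \<notin> A \<and> s - b \<in> A}) \<le> \<tau>"
    and \<tau>: "\<tau> \<ge> 0"
  shows "card ({t..<mid} - A) = u" and "real u \<le> 32 * \<tau> + 8 * real q"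
proof -
  define X where "X = A \<inter> {..<t}"
  define Y where "Y = {t..<mid} - A"
  have tm: "t \<le> mid" by (simp add: t_def)
  have finX: "finite X" and finY: "finite Y" using finA by (auto simp: X_def Y_def)
  have cX: "card X = u" by (simp add: X_def u_def)
  have cY: "card Y = u"
  proof -
    have "A \<inter> {..<mid} = X \<union> (A \<inter> {t..<mid})" using tm by (auto simp: X_def)
    hence "card (A \<inter> {..<mid}) = card X + card (A \<inter> {t..<mid})"
      using finA by (simp add: card_Un_disjoint X_def Int_def disjoint_iff)
    moreover have "card {t..<mid} = card (A \<inter> {t..<mid}) + card Y"
      using card_Int_Diff[of "{t..<mid}" A] by (simp add: Y_def Int_commute)
    moreover have "card {t..<mid} = card (A \<inter> {..<mid})" by (simp add: t_def)
    ultimately show ?thesis using cX by linarith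
  qed
  thus "card ({t..<mid} - A) = u" by (simp add: Y_def)
  define J where "J b = card {s. s < mid \<and> s \<notin> A \<and> s - b \<in> A}" for b
  define I where "I = {1..8 * int u}"
  define P where "P = {(s, b). b \<in> I \<and> s < mid \<and> s \<notin> A \<and> s - b \<in> A}"
  have finP: "finite P"
  proof (rule finite_subset)
    show "P \<subseteq> (\<lambda>(a, b). (a + b, b)) ` (A \<times> I)" by (force simp: P_def)
    show "finite ((\<lambda>(a, b). (a + b, b)) ` (A \<times> I))" using finA by (auto simp: I_def)
  qed
  have cP: "card P = (\<Sum>b\<in>I. J b)"
  proof -
    have "card P = (\<Sum>b\<in>I. card {s. (s, b) \<in> P})"
      by (rule card_Sigma_eq_sum[OF finP]) (auto simp: P_def I_def)
    also have "\<dots> = (\<Sum>b\<in>I. J b)"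
      by (intro sum.cong) (auto simp: J_def P_def)
    finally show ?thesis .
  qed
  \<comment> \<open>a non-element reached from \<open>A\<close> is a gap or comes from a stray element; this serves for shifts
    outside \<open>S\<close>, about which nothing is known\<close>
  have J_le: "J b \<le> 2 * u" if "b \<in> I" for b
  proof -
    have "{s. s < mid \<and> s \<notin> A \<and> s - b \<in> A} \<subseteq> Y \<union> (\<lambda>x. x + b) ` X"
    proof
      fix s assume s: "s \<in> {s. s < mid \<and> s \<notin> A \<and> s - b \<in> A}"
      show "s \<in> Y \<union> (\<lambda>x. x + b) ` X"
      proof (cases "s \<ge> t")
        case True thus ?thesis using s by (simp add: Y_def)
      next
        case False
        hence "s - b \<in> X" using s that by (simp add: X_def I_def)
        thus ?thesis by force
      qed
    qed
    hence "J b \<le> card (Y \<union> (\<lambda>x. x + b) ` X)"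
      unfolding J_def using finX finY by (intro card_mono) auto
    also have "\<dots> \<le> card Y + card ((\<lambda>x. x + b) ` X)" by (rule card_Un_le)
    also have "\<dots> = 2 * u" by (simp add: card_image cX cY)
    finally show ?thesis .
  qed
  have upper: "real (card P) \<le> 8 * real u * \<tau> + 2 * real u * real q"
  proof -
    have I: "I = (I \<inter> S) \<union> (I - S)" "finite I" by (auto simp: I_def)
    have "real (card P) = (\<Sum>b\<in>I \<inter> S. real (J b)) + (\<Sum>b\<in>I - S. real (J b))"
      unfolding cP of_nat_sum by (subst I(1), rule sum.union_disjoint) (use I in auto)
    also have "(\<Sum>b\<in>I \<inter> S. real (J b)) \<le> (\<Sum>b\<in>I \<inter> S. \<tau>)"
      using inv by (intro sum_mono) (auto simp: J_def)
    also have "\<dots> \<le> (\<Sum>b\<in>I. \<tau>)" using \<tau> I by (intro sum_mono2) auto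
    also have "\<dots> = 8 * real u * \<tau>" by (simp add: I_def)
    also have "(\<Sum>b\<in>I - S. real (J b)) \<le> (\<Sum>b\<in>I - S. real (2 * u))"
      using J_le by (intro sum_mono of_nat_mono) auto
    also have "\<dots> = 2 * real u * real (card (I - S))" by simp
    also have "\<dots> \<le> 2 * real u * real q" using S by (intro mult_left_mono) (auto simp: I_def)
    finally show ?thesis by simp
  qed
  have many: "3 * u \<le> card ({1..4 * int u} - Z)"
    if Z: "card ({1..4 * int u} \<inter> Z) \<le> u" for Z
  proof -
    have "card {1..4 * int u} = card ({1..4 * int u} \<inter> Z) + card ({1..4 * int u} - Z)"
      by (rule card_Int_Diff) simp
    thus ?thesis using Z by simp
  qed
  have lower: "(real u)\<^sup>2 \<le> 4 * real (card P)"
  proof -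
    let ?Y1 = "{y \<in> Y. y \<ge> t + 4 * int u}" and ?Y0 = "{y \<in> Y. y < t + 4 * int u}"
    let ?X1 = "{x \<in> X. x < t - 4 * int u}" and ?X0 = "{x \<in> X. x \<ge> t - 4 * int u}"
    have sY: "card ?Y0 + card ?Y1 = u"
    proof -
      have "Y = ?Y0 \<union> ?Y1" by auto
      hence "card Y = card (?Y0 \<union> ?Y1)" by (rule arg_cong)
      also have "\<dots> = card ?Y0 + card ?Y1" using finY by (intro card_Un_disjoint) auto
      finally show ?thesis using cY by simp
    qed
    have sX: "card ?X0 + card ?X1 = u"
    proof -
      have "X = ?X0 \<union> ?X1" by auto
      hence "card X = card (?X0 \<union> ?X1)" by (rule arg_cong)
      also have "\<dots> = card ?X0 + card ?X1" using finX by (intro card_Un_disjoint) auto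
      finally show ?thesis using cX by simp
    qed
    consider "2 * card ?Y1 \<ge> u" | "2 * card ?X1 \<ge> u" | "2 * card ?Y0 \<ge> u" "2 * card ?X0 \<ge> u"
      using sX sY by linarith
    hence "u * u \<le> 4 * card P"
    proof cases
      case 1
      let ?Q = "SIGMA y:?Y1. ({1..4 * int u} - {b. y - b \<in> Y})"
      have "card ({1..4 * int u} - {b. y - b \<in> Y}) \<ge> 3 * u" if "y \<in> ?Y1" for y
      proof -
        have "card ({1..4 * int u} \<inter> {b. y - b \<in> Y}) \<le> card Y"
          by (rule card_inj_on_le[of "\<lambda>b. y - b"]) (auto simp: finY inj_on_def)
        thus ?thesis using many[of "{b. y - b \<in> Y}"] cY by simp
      qed
      hence "(\<Sum>y\<in>?Y1. 3 * u) \<le> (\<Sum>y\<in>?Y1. card ({1..4 * int u} - {b. y - b \<in> Y}))"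
        by (rule sum_mono)
      also have "\<dots> = card ?Q" using finY by (intro card_SigmaI [symmetric]) auto
      also have "\<dots> \<le> card P"
      proof (rule card_mono[OF finP])
        show "?Q \<subseteq> P" by (auto simp: P_def I_def Y_def)
      qed
      finally have "card ?Y1 * (3 * u) \<le> card P" by simp
      moreover have "u * (3 * u) \<le> (2 * card ?Y1) * (3 * u)" using 1 by (rule mult_le_mono1)
      moreover have "(2 * card ?Y1) * (3 * u) = 2 * (card ?Y1 * (3 * u))" by (rule mult.assoc)
      moreover have "u * u \<le> u * (3 * u)" by simp
      ultimately show ?thesis by linarith
    next
      case 2
      let ?Q = "SIGMA x:?X1. ({1..4 * int u} - {b. x + b \<in> X})"
      have "card ({1..4 * int u} - {b. x + b \<in> X}) \<ge> 3 * u" if "x \<in> ?X1" for x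
      proof -
        have "card ({1..4 * int u} \<inter> {b. x + b \<in> X}) \<le> card X"
          by (rule card_inj_on_le[of "\<lambda>b. x + b"]) (auto simp: finX inj_on_def)
        thus ?thesis using many[of "{b. x + b \<in> X}"] cX by simp
      qed
      hence "(\<Sum>x\<in>?X1. 3 * u) \<le> (\<Sum>x\<in>?X1. card ({1..4 * int u} - {b. x + b \<in> X}))"
        by (rule sum_mono)
      also have "\<dots> = card ?Q" using finX by (intro card_SigmaI [symmetric]) auto
      also have "\<dots> \<le> card P"
      proof (rule card_inj_on_le[OF _ _ finP])
        show "inj_on (\<lambda>(x, b). (x + b, b)) ?Q" by (auto simp: inj_on_def)
        show "(\<lambda>(x, b). (x + b, b)) ` ?Q \<subseteq> P" using tm by (auto simp: P_def I_def X_def)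
      qed
      finally have "card ?X1 * (3 * u) \<le> card P" by simp
      moreover have "u * (3 * u) \<le> (2 * card ?X1) * (3 * u)" using 2 by (rule mult_le_mono1)
      moreover have "(2 * card ?X1) * (3 * u) = 2 * (card ?X1 * (3 * u))" by (rule mult.assoc)
      moreover have "u * u \<le> u * (3 * u)" by simp
      ultimately show ?thesis by linarith
    next
      case 3
      have "card (?X0 \<times> ?Y0) \<le> card P"
      proof (rule card_inj_on_le[OF _ _ finP])
        show "inj_on (\<lambda>(x, y). (y, y - x)) (?X0 \<times> ?Y0)" by (auto simp: inj_on_def)
        show "(\<lambda>(x, y). (y, y - x)) ` (?X0 \<times> ?Y0) \<subseteq> P"
          by (auto simp: P_def I_def X_def Y_def)
      qed
      hence "card ?X0 * card ?Y0 \<le> card P" by (simp add: card_cartesian_product)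
      moreover have "u * u \<le> (2 * card ?X0) * (2 * card ?Y0)" using 3 by (intro mult_le_mono)
      moreover have "(2 * card ?X0) * (2 * card ?Y0) = 4 * (card ?X0 * card ?Y0)" by simp
      ultimately show ?thesis by linarith
    qed
    hence "real (u * u) \<le> real (4 * card P)" using of_nat_le_iff by blast
    thus ?thesis by (simp add: power2_eq_square)
  qed
  show "real u \<le> 32 * \<tau> + 8 * real q"
  proof (cases "u = 0")
    case True thus ?thesis using \<tau> by simp
  next
    case False
    have "real u * real u \<le> real u * (32 * \<tau> + 8 * real q)"
      using upper lower by (simp add: power2_eq_square algebra_simps)
    thus ?thesis using False by simp
  qed
qed

text \<open>
The mirror image of the previous lemma, under \<open>x \<mapsto> - x\<close>.
\<close>
lemma few_inversions_right:
  fixes A S :: "int set" and mid m :: int and \<tau> :: real and q :: nat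
  assumes finA: "finite A"
  defines "t \<equiv> mid + int (card (A \<inter> {mid..}))"
  defines "u \<equiv> card (A \<inter> {t..})"
  assumes S: "card ({1..8 * int u} - S) \<le> q"
    and inv: "\<And>b. b \<in> S \<Longrightarrow> real (card {s. s \<ge> mid \<and> s \<notin> A \<and> s + b \<in> A}) \<le> \<tau>"
    and \<tau>: "\<tau> \<ge> 0"
  shows "card ({mid..<t} - A) = u" and "real u \<le> 32 * \<tau> + 8 * real q"
proof -
  have mem: "x \<in> uminus ` Z \<longleftrightarrow> - x \<in> Z" for x :: int and Z by force
  have cardneg: "card (uminus ` Z) = card Z" for Z :: "int set" by (simp add: card_image)
  have "uminus ` A \<inter> {..<1 - mid} = uminus ` (A \<inter> {mid..})" by force
  hence t: "1 - mid - int (card (uminus ` A \<inter> {..<1 - mid})) = 1 - t"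
    by (simp add: cardneg t_def)
  have "uminus ` A \<inter> {..<1 - t} = uminus ` (A \<inter> {t..})" by force
  hence u: "card (uminus ` A \<inter> {..<1 - t}) = u" by (simp add: cardneg u_def)
  have inv': "real (card {s. s < 1 - mid \<and> s \<notin> uminus ` A \<and> s - b \<in> uminus ` A}) \<le> \<tau>"
    if "b \<in> S" for b
  proof -
    have "{s. s < 1 - mid \<and> s \<notin> uminus ` A \<and> s - b \<in> uminus ` A} =
        uminus ` {s. s \<ge> mid \<and> s \<notin> A \<and> s + b \<in> A}"
      unfolding set_eq_iff mem mem_Collect_eq by (auto simp: algebra_simps)
    thus ?thesis using inv[OF that] by (simp add: cardneg)
  qed
  have Y: "{1 - t..<1 - mid} - uminus ` A = uminus ` ({mid..<t} - A)"
    unfolding set_eq_iff mem Diff_iff by auto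
  have *: "finite (uminus ` A)" using finA by simp
  note L = few_inversions_left[OF *, of "1 - mid", unfolded t u, OF S inv' \<tau>]
  show "card ({mid..<t} - A) = u" using L(1) by (simp add: Y cardneg)
  show "real u \<le> 32 * \<tau> + 8 * real q" using L(2) by simp
qed


section \<open>Bootstrapping the defect\<close>

text \<open>
A cut of \<open>A\<close> at \<open>mid\<close>. The ends \<open>tL\<close> and \<open>tR\<close> are those of the interval
that has as many elements as \<open>A\<close> on either side of the cut, so that on each side the stray elements outside are
as many as the gaps inside.
\<close>
locale split_shift_pair = shift_pair +
  fixes mid :: int
begin

definition nL :: nat where "nL = card (A \<inter> {..<mid})"
definition nR :: nat where "nR = card (A \<inter> {mid..})"
definition tL :: int where "tL = mid - int nL"
definition tR :: int where "tR = mid + int nR"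
definition strayL :: nat where "strayL = card (A \<inter> {..<tL})"
definition strayR :: nat where "strayR = card (A \<inter> {tR..})"
definition missing :: nat where "missing = nat (m + 1 - int n)"
definition defect :: nat where "defect = strayL + strayR + missing"

lemma n_split: "nL + nR = n"
proof -
  have "A = (A \<inter> {..<mid}) \<union> (A \<inter> {mid..})" by auto
  hence "card A = card ((A \<inter> {..<mid}) \<union> (A \<inter> {mid..}))" by (rule arg_cong)
  also have "\<dots> = nL + nR" unfolding nL_def nR_def using finA by (intro card_Un_disjoint) auto
  finally show ?thesis using cardA by simp
qed

lemma int_missing: "int missing = m + 1 - int n"
  using m_ge by (simp add: missing_def)

lemma tR_eq: "tR = tL + int n"
  using n_split by (simp add: tL_def tR_def)

lemma t_mid: "tL \<le> mid" "mid \<le> tR"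
  by (simp_all add: tL_def tR_def)

lemma card_gaps_left: "card ({tL..<mid} - A) = strayL"
proof -
  have "A \<inter> {..<mid} = (A \<inter> {..<tL}) \<union> (A \<inter> {tL..<mid})" using t_mid by auto
  hence "nL = card ((A \<inter> {..<tL}) \<union> (A \<inter> {tL..<mid}))" unfolding nL_def by (rule arg_cong)
  also have "\<dots> = strayL + card (A \<inter> {tL..<mid})"
    unfolding strayL_def using finA by (intro card_Un_disjoint) auto
  finally have "nL = strayL + card (A \<inter> {tL..<mid})" .
  moreover have "card {tL..<mid} = card (A \<inter> {tL..<mid}) + card ({tL..<mid} - A)"
    using card_Int_Diff[of "{tL..<mid}" A] by (simp add: Int_commute)
  moreover have "card {tL..<mid} = nL" by (simp add: tL_def)
  ultimately show ?thesis by linarith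
qed

lemma card_gaps_right: "card ({mid..<tR} - A) = strayR"
proof -
  have "A \<inter> {mid..} = (A \<inter> {tR..}) \<union> (A \<inter> {mid..<tR})" using t_mid by auto
  hence "nR = card ((A \<inter> {tR..}) \<union> (A \<inter> {mid..<tR}))" unfolding nR_def by (rule arg_cong)
  also have "\<dots> = strayR + card (A \<inter> {mid..<tR})"
    unfolding strayR_def using finA by (intro card_Un_disjoint) auto
  finally have "nR = strayR + card (A \<inter> {mid..<tR})" .
  moreover have "card {mid..<tR} = card (A \<inter> {mid..<tR}) + card ({mid..<tR} - A)"
    using card_Int_Diff[of "{mid..<tR}" A] by (simp add: Int_commute)
  moreover have "card {mid..<tR} = nR" by (simp add: tR_def)
  ultimately show ?thesis by linarith
qed

lemma card_missing_shifts: "card ({0..m} - B) = missing"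
  using card_Diff_subset[OF finB Bsub] cardB by (simp add: missing_def nat_diff_distrib' m_pos less_imp_le)

text \<open>
The elements that \<open>A + b\<close> adds to \<open>A\<close> at the left end; \<open>invR\<close> counts those that
\<open>A + b\<close> adds to \<open>A + m\<close> at the right end.
\<close>
definition invL :: "int \<Rightarrow> nat" where
  "invL b = card {s. s < mid \<and> s \<notin> A \<and> s - b \<in> A}"

definition invR :: "int \<Rightarrow> nat" where
  "invR b = card {s. s \<ge> mid \<and> s \<notin> A \<and> s + (m - b) \<in> A}"

text \<open>
The part of the \<open>m\<close> integers after the cut that the shifts \<open>0\<close> and \<open>m\<close> leave
uncovered.
\<close>
definition uncovered :: "int set" where
  "uncovered = {z \<in> {mid..<mid + m}. z \<notin> A \<and> z - m \<notin> A}"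

lemma finite_uncovered [simp]: "finite uncovered"
  by (rule finite_subset[of _ "{mid..<mid + m}"]) (auto simp: uncovered_def)

lemma finite_inv: "finite {s. s < mid \<and> s \<notin> A \<and> s - b \<in> A}" "finite {s. s \<ge> mid \<and> s \<notin> A \<and> s + b \<in> A}"
proof -
  show "finite {s. s < mid \<and> s \<notin> A \<and> s - b \<in> A}"
    by (rule finite_subset[of _ "(\<lambda>a. a + b) ` A"]) (use finA in force)+
  show "finite {s. s \<ge> mid \<and> s \<notin> A \<and> s + b \<in> A}"
    by (rule finite_subset[of _ "(\<lambda>a. a - b) ` A"]) (use finA in force)+
qed

text \<open>
Count the sumset in three zones: below \<open>mid\<close> there are \<open>A\<close> and the inversions of \<open>b\<close>,
from \<open>mid + m\<close> on there are \<open>A + m\<close> and the inversions of \<open>b'\<close>, and in between only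
the uncovered points that neither shift reaches are missing.
\<close>
lemma split_count:
  assumes b: "b \<in> B" "b' \<in> B"
  shows "real (invL b) + real (invR b') + real missing \<le>
    e + real (card {z \<in> uncovered. z - b \<notin> A \<and> z - b' \<notin> A})"
proof -
  let ?C = "A + {0, m, b, b'}"
  note finC = finite_sumset[of b b']
  have mem: "x \<in> ?C \<longleftrightarrow> x \<in> A \<or> x - m \<in> A \<or> x - b \<in> A \<or> x - b' \<in> A" for x
  proof
    show "x \<in> ?C \<Longrightarrow> x \<in> A \<or> x - m \<in> A \<or> x - b \<in> A \<or> x - b' \<in> A"
      by (auto simp: set_plus_def)
    assume "x \<in> A \<or> x - m \<in> A \<or> x - b \<in> A \<or> x - b' \<in> A"
    then obtain c where "c \<in> {0, m, b, b'}" "x - c \<in> A" by force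
    thus "x \<in> ?C" using set_plus_intro[of "x - c" A c "{0, m, b, b'}"] by simp
  qed
  let ?C1 = "?C \<inter> {..<mid}" and ?C2 = "?C \<inter> {mid..<mid + m}" and ?C3 = "?C \<inter> {mid + m..}"
  have "?C = (?C1 \<union> ?C2) \<union> ?C3" using m_pos by auto
  hence "card ?C = card ((?C1 \<union> ?C2) \<union> ?C3)" by (rule arg_cong)
  also have "\<dots> = card (?C1 \<union> ?C2) + card ?C3" using finC m_pos by (intro card_Un_disjoint) auto
  also have "card (?C1 \<union> ?C2) = card ?C1 + card ?C2" using finC by (intro card_Un_disjoint) auto
  finally have C: "card ?C = card ?C1 + card ?C2 + card ?C3" .
  have 1: "nL + invL b \<le> card ?C1"
  proof -
    have "nL + invL b = card ((A \<inter> {..<mid}) \<union> {s. s < mid \<and> s \<notin> A \<and> s - b \<in> A})"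
      unfolding nL_def invL_def using finA finite_inv by (intro card_Un_disjoint [symmetric]) auto
    also have "\<dots> \<le> card ?C1" using finC by (intro card_mono) (auto simp: mem)
    finally show ?thesis .
  qed
  have 3: "nR + invR b' \<le> card ?C3"
  proof -
    have "nR + invR b' = card ((A \<inter> {mid..}) \<union> {s. s \<ge> mid \<and> s \<notin> A \<and> s + (m - b') \<in> A})"
      unfolding nR_def invR_def using finA finite_inv by (intro card_Un_disjoint [symmetric]) auto
    also have "\<dots> \<le> card ?C3"
      using finC by (intro card_inj_on_le[of "\<lambda>x. x + m"]) (auto simp: mem algebra_simps)
    finally show ?thesis .
  qed
  have 2: "m \<le> int (card ?C2) + int (card {z \<in> uncovered. z - b \<notin> A \<and> z - b' \<notin> A})"
  proof -
    have "card {mid..<mid + m} = card ({mid..<mid + m} \<inter> ?C) + card ({mid..<mid + m} - ?C)"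
      by (rule card_Int_Diff) simp
    also have "{mid..<mid + m} - ?C = {z \<in> uncovered. z - b \<notin> A \<and> z - b' \<notin> A}"
      by (auto simp: uncovered_def mem)
    finally show ?thesis using m_pos by (simp add: Int_commute)
  qed
  have "real (card ?C) \<ge> real nL + real (invL b) + real (card ?C2) + real nR + real (invR b')"
    using C 1 3 by linarith
  moreover have "real (card ?C) \<le> 2 * real n - 1 + e" by (rule four[OF b])
  moreover have "real_of_int m \<le> real (card ?C2) + real (card {z \<in> uncovered. z - b \<notin> A \<and> z - b' \<notin> A})"
    using 2 by linarith
  moreover have "real nL + real nR = real n" using n_split by linarith
  moreover have "real missing = real_of_int m + 1 - real n" using int_missing by linarith
  ultimately show ?thesis by linarith
qed

text \<open>
The points \<open>z - b\<close> that are not in \<open>A\<close> are gaps of \<open>A\<close> or they are among the first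
\<open>missing\<close> integers from \<open>tR\<close> on.
\<close>
lemma misses_le:
  assumes S: "finite S" "\<And>b. b \<in> S \<Longrightarrow> tL \<le> z - b \<and> z - b < tR + int missing"
  shows "card {b \<in> S. z - b \<notin> A} \<le> defect"
proof -
  let ?U = "(({tL..<mid} - A) \<union> ({mid..<tR} - A)) \<union> {tR..<tR + int missing}"
  have "card {b \<in> S. z - b \<notin> A} \<le> card ?U"
    by (rule card_inj_on_le[of "\<lambda>b. z - b"]) (use S in \<open>force simp: inj_on_def\<close>)+
  also have "\<dots> \<le> card (({tL..<mid} - A) \<union> ({mid..<tR} - A)) + card {tR..<tR + int missing}"
    by (rule card_Un_le)
  also have "card (({tL..<mid} - A) \<union> ({mid..<tR} - A)) \<le> card ({tL..<mid} - A) + card ({mid..<tR} - A)"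
    by (rule card_Un_le)
  finally show ?thesis by (simp add: card_gaps_left card_gaps_right defect_def)
qed

lemma card_uncovered_le: "card uncovered \<le> defect"
proof -
  let ?U = "(({mid..<tR} - A) \<union> (\<lambda>y. y + m) ` ({tL..<mid} - A)) \<union> {tR..<tL + m}"
  have "uncovered \<subseteq> ?U"
  proof
    fix z assume z: "z \<in> uncovered"
    show "z \<in> ?U"
    proof (cases "z < tR \<or> z < tL + m")
      case True thus ?thesis using z by (auto simp: uncovered_def)
    next
      case False
      hence "z - m \<in> {tL..<mid} - A" using z by (auto simp: uncovered_def)
      thus ?thesis by force
    qed
  qed
  hence "card uncovered \<le> card ?U" by (intro card_mono) auto
  also have "\<dots> \<le> card (({mid..<tR} - A) \<union> (\<lambda>y. y + m) ` ({tL..<mid} - A)) + card {tR..<tL + m}"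
    by (rule card_Un_le)
  also have "card (({mid..<tR} - A) \<union> (\<lambda>y. y + m) ` ({tL..<mid} - A)) \<le>
      card ({mid..<tR} - A) + card ((\<lambda>y. y + m) ` ({tL..<mid} - A))"
    by (rule card_Un_le)
  also have "card ((\<lambda>y. y + m) ` ({tL..<mid} - A)) = strayL"
    by (simp add: card_image card_gaps_left)
  also have "card {tR..<tL + m} \<le> missing" using tR_eq by (simp add: missing_def)
  finally show ?thesis by (simp add: card_gaps_right defect_def)
qed

definition quarter :: int where "quarter = int (n div 4)"

text \<open>
The gaps of \<open>A\<close> at distance at least about \<open>n/4\<close> from the ends. Near gaps are reached by shifts of
medium length; the far ones have to be bounded separately.
\<close>
definition far_gaps :: nat where
  "far_gaps = card (({tL..<mid} - A) \<inter> {tL + quarter..}) + card (({mid..<tR} - A) \<inter> {..<tR - quarter})"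

text \<open>
The interval contains more than \<open>n/4\<close> integers, and at most \<open>defect\<close> of them are outside
\<open>B\<close>.
\<close>
lemma shifts_in_interval:
  assumes "a \<ge> 0" "a + quarter \<le> m" and defect: "4000 * defect \<le> n"
  shows "5 * card (B \<inter> {a..a + quarter}) \<ge> n"
proof -
  have "card {a..a + quarter} = card ({a..a + quarter} \<inter> B) + card ({a..a + quarter} - B)"
    by (rule card_Int_Diff) simp
  moreover have "card ({a..a + quarter} - B) \<le> card ({0..m} - B)"
    using assms by (intro card_mono) auto
  moreover have "card {a..a + quarter} = n div 4 + 1" by (simp add: quarter_def nat_add_distrib)
  ultimately have "n div 4 + 1 \<le> card (B \<inter> {a..a + quarter}) + missing"
    by (simp add: card_missing_shifts Int_commute)
  moreover have "4 * (n div 4 + 1) > n" by presburger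
  moreover have "missing \<le> defect" by (simp add: defect_def)
  ultimately show ?thesis using defect by linarith
qed

text \<open>
Use a short shift \<open>b\<close> and a shift \<open>b'\<close> close to \<open>m\<close>, both varying over an interval of
length \<open>n div 4\<close>. Uncovered points in the left part of the middle zone are reached by most of the short shifts,
those in the right part by most of the long ones. Moreover a far gap in the left half of \<open>A\<close> is an inversion for
most short shifts, and symmetrically on the right. By averaging, all but \<open>O(defect\<^sup>2/n)\<close> of the middle
zone is covered and all but \<open>O(defect\<^sup>2/n)\<close> of the far gaps give new elements.
\<close>
lemma few_far_gaps:
  assumes defect: "4000 * defect \<le> n" and nL: "quarter \<le> int nL" and nR: "quarter \<le> int nR"
  shows "real missing + real far_gaps \<le> e + 20 * (real defect)\<^sup>2 / real n"
proof -
  have g0: "quarter \<ge> 0" and g4: "4 * quarter \<le> int n" by (auto simp: quarter_def)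
  have gm: "quarter \<le> m" using g4 m_ge m_pos by linarith
  let ?farL = "(({tL..<mid} - A) \<inter> {tL + quarter..})" and ?farR = "(({mid..<tR} - A) \<inter> {..<tR - quarter})"
  let ?G1 = "{z \<in> uncovered. z < tR + int missing}" and ?G2 = "{z \<in> uncovered. z \<ge> tR + int missing}"
  let ?B1 = "B \<inter> {0..quarter}" and ?B2 = "B \<inter> {m - quarter..m}"
  let ?U1 = "?G1 \<union> ?farL" and ?U2 = "?G2 \<union> (\<lambda>y. y + m) ` ?farR"
  have farL_le: "card ?farL \<le> strayL" unfolding card_gaps_left [symmetric] by (intro card_mono) auto
  have farR_le: "card ?farR \<le> strayR" unfolding card_gaps_right [symmetric] by (intro card_mono) auto
  have fin: "finite {z \<in> ?G1. Q z}" "finite {z \<in> ?G2. Q z}"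
    "finite {y \<in> ?farL. Q y}" "finite {y \<in> ?farR. Q y}" for Q
    by (rule finite_subset[OF _ finite_uncovered], blast)+
      (rule finite_subset[of _ "{tL..<mid}"], auto, rule finite_subset[of _ "{mid..<tR}"], auto)
  have G1_le: "card ?G1 \<le> defect" by (rule order_trans[OF card_mono card_uncovered_le]) auto
  have G2_le: "card ?G2 \<le> defect" by (rule order_trans[OF card_mono card_uncovered_le]) auto
  have n0: "n > 0" using n2 by simp
  have choose: "\<exists>b\<in>S. real (card {z \<in> U. z - b \<notin> A}) \<le> 10 * (real defect)\<^sup>2 / real n"
    if "finite U" "finite S" "5 * card S \<ge> n" "card U \<le> 2 * defect"
      "\<And>z. z \<in> U \<Longrightarrow> card {b \<in> S. z - b \<notin> A} \<le> defect" for U S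
  proof -
    have "S \<noteq> {}" using that(3) n0 by auto
    hence "\<exists>b\<in>S. card {z \<in> U. z - b \<notin> A} * card S \<le> defect * card U"
      by (rule average_exists[OF that(1,2) _ that(5)])
    then obtain b where b: "b \<in> S" "card {z \<in> U. z - b \<notin> A} * card S \<le> defect * card U"
      by blast
    have "card {z \<in> U. z - b \<notin> A} * n \<le> card {z \<in> U. z - b \<notin> A} * (5 * card S)"
      using that(3) by (rule mult_le_mono2)
    also have "\<dots> = 5 * (card {z \<in> U. z - b \<notin> A} * card S)" by simp
    also have "\<dots> \<le> 5 * (defect * card U)" using b(2) by (rule mult_le_mono2)
    also have "\<dots> \<le> 5 * (defect * (2 * defect))" using that(4) by (intro mult_le_mono2)
    finally have "real (card {z \<in> U. z - b \<notin> A} * n) \<le> real (5 * (defect * (2 * defect)))"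
      using of_nat_le_iff by blast
    hence "real (card {z \<in> U. z - b \<notin> A}) \<le> 10 * (real defect)\<^sup>2 / real n"
      using n0 by (simp add: field_simps power2_eq_square)
    thus ?thesis using b(1) by blast
  qed
  have "\<exists>b\<in>?B1. real (card {z \<in> ?U1. z - b \<notin> A}) \<le> 10 * (real defect)\<^sup>2 / real n"
  proof (rule choose)
    show "5 * card ?B1 \<ge> n" using shifts_in_interval[of 0] gm defect by simp
    have "card ?U1 \<le> card ?G1 + card ?farL" by (rule card_Un_le)
    thus "card ?U1 \<le> 2 * defect" using G1_le farL_le by (simp add: defect_def)
    \<comment> \<open>the length \<open>n div 4\<close> does not take points right of \<open>mid\<close> below \<open>tL\<close>\<close>
    fix z assume z: "z \<in> ?U1"
    show "card {b \<in> ?B1. z - b \<notin> A} \<le> defect"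
      using z nL t_mid by (intro misses_le) (auto simp: uncovered_def tL_def)
  qed auto
  then obtain b where b: "b \<in> ?B1" "real (card {z \<in> ?U1. z - b \<notin> A}) \<le> 10 * (real defect)\<^sup>2 / real n"
    by blast
  have "\<exists>b\<in>?B2. real (card {z \<in> ?U2. z - b \<notin> A}) \<le> 10 * (real defect)\<^sup>2 / real n"
  proof (rule choose)
    show "5 * card ?B2 \<ge> n" using shifts_in_interval[of "m - quarter"] g0 gm defect by simp
    have "card ?U2 \<le> card ?G2 + card ((\<lambda>y. y + m) ` ?farR)" by (rule card_Un_le)
    also have "card ((\<lambda>y. y + m) ` ?farR) = card ?farR" by (simp add: card_image)
    finally show "card ?U2 \<le> 2 * defect" using G2_le farR_le by (simp add: defect_def)
    fix z assume z: "z \<in> ?U2"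
    show "card {b \<in> ?B2. z - b \<notin> A} \<le> defect"
    proof (rule misses_le)
      fix b' assume b': "b' \<in> ?B2"
      show "tL \<le> z - b' \<and> z - b' < tR + int missing"
        using z
      proof
        assume "z \<in> ?G2"
        thus ?thesis using b' nR tR_eq int_missing by (auto simp: uncovered_def tR_def)
      next
        assume "z \<in> (\<lambda>y. y + m) ` ?farR"
        thus ?thesis using b' t_mid by auto
      qed
    qed simp
  qed auto
  then obtain b' where b': "b' \<in> ?B2" "real (card {z \<in> ?U2. z - b' \<notin> A}) \<le> 10 * (real defect)\<^sup>2 / real n"
    by blast
  have L: "card ?farL + card {z \<in> ?G1. z - b \<notin> A} \<le> invL b + card {z \<in> ?U1. z - b \<notin> A}"
  proof -
    have "{z \<in> ?U1. z - b \<notin> A} = {z \<in> ?G1. z - b \<notin> A} \<union> {y \<in> ?farL. y - b \<notin> A}" by auto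
    hence "card {z \<in> ?U1. z - b \<notin> A} = card ({z \<in> ?G1. z - b \<notin> A} \<union> {y \<in> ?farL. y - b \<notin> A})"
      by (rule arg_cong)
    also have "\<dots> = card {z \<in> ?G1. z - b \<notin> A} + card {y \<in> ?farL. y - b \<notin> A}"
      by (intro card_Un_disjoint fin) (auto simp: uncovered_def)
    finally have 1: "card {z \<in> ?U1. z - b \<notin> A} = card {z \<in> ?G1. z - b \<notin> A} + card {y \<in> ?farL. y - b \<notin> A}" .
    have "?farL \<subseteq> {s. s < mid \<and> s \<notin> A \<and> s - b \<in> A} \<union> {y \<in> ?farL. y - b \<notin> A}" by auto
    hence "card ?farL \<le> card ({s. s < mid \<and> s \<notin> A \<and> s - b \<in> A} \<union> {y \<in> ?farL. y - b \<notin> A})"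
      by (intro card_mono finite_UnI finite_inv fin)
    also have "\<dots> \<le> invL b + card {y \<in> ?farL. y - b \<notin> A}"
      unfolding invL_def by (rule card_Un_le)
    finally show ?thesis using 1 by linarith
  qed
  have R: "card ?farR + card {z \<in> ?G2. z - b' \<notin> A} \<le> invR b' + card {z \<in> ?U2. z - b' \<notin> A}"
  proof -
    let ?F = "{y \<in> ?farR. y + m - b' \<notin> A}"
    have "{z \<in> ?U2. z - b' \<notin> A} = {z \<in> ?G2. z - b' \<notin> A} \<union> (\<lambda>y. y + m) ` ?F" by auto
    hence "card {z \<in> ?U2. z - b' \<notin> A} = card ({z \<in> ?G2. z - b' \<notin> A} \<union> (\<lambda>y. y + m) ` ?F)"
      by (rule arg_cong)
    also have "\<dots> = card {z \<in> ?G2. z - b' \<notin> A} + card ((\<lambda>y. y + m) ` ?F)"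
      by (intro card_Un_disjoint fin finite_imageI) (auto simp: uncovered_def)
    also have "card ((\<lambda>y. y + m) ` ?F) = card ?F" by (simp add: card_image)
    finally have 1: "card {z \<in> ?U2. z - b' \<notin> A} = card {z \<in> ?G2. z - b' \<notin> A} + card ?F" .
    have "?farR \<subseteq> {s. s \<ge> mid \<and> s \<notin> A \<and> s + (m - b') \<in> A} \<union> ?F" by (auto simp: algebra_simps)
    hence "card ?farR \<le> card ({s. s \<ge> mid \<and> s \<notin> A \<and> s + (m - b') \<in> A} \<union> ?F)"
      by (intro card_mono finite_UnI finite_inv fin)
    also have "\<dots> \<le> invR b' + card ?F"
      unfolding invR_def by (rule card_Un_le)
    finally show ?thesis using 1 by linarith
  qed
  have G: "card {z \<in> uncovered. z - b \<notin> A \<and> z - b' \<notin> A} \<le>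
      card {z \<in> ?G1. z - b \<notin> A} + card {z \<in> ?G2. z - b' \<notin> A}"
  proof -
    have "card {z \<in> uncovered. z - b \<notin> A \<and> z - b' \<notin> A} \<le>
        card ({z \<in> ?G1. z - b \<notin> A} \<union> {z \<in> ?G2. z - b' \<notin> A})"
      by (intro card_mono finite_UnI fin) auto
    also have "\<dots> \<le> card {z \<in> ?G1. z - b \<notin> A} + card {z \<in> ?G2. z - b' \<notin> A}"
      by (rule card_Un_le)
    finally show ?thesis .
  qed
  have "real (invL b) + real (invR b') + real missing \<le>
    e + real (card {z \<in> uncovered. z - b \<notin> A \<and> z - b' \<notin> A})"
    using b b' by (intro split_count) auto
  moreover have "real far_gaps = real (card ?farL) + real (card ?farR)" by (simp add: far_gaps_def)
  ultimately have "real missing + real far_gaps \<le> e + (real (card {z \<in> ?U1. z - b \<notin> A}) + real (card {z \<in> ?U2. z - b' \<notin> A}))"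
    using of_nat_mono[OF L, where 'a = real] of_nat_mono[OF R, where 'a = real] of_nat_mono[OF G, where 'a = real]
    unfolding of_nat_add by linarith
  thus ?thesis using b(2) b'(2) by simp
qed

text \<open>
Let one shift be \<open>b\<close> and choose the other one of length between \<open>n/4\<close> and \<open>n/2\<close> so
that it covers the uncovered points apart from the far gaps and \<open>O(defect\<^sup>2/n)\<close> exceptions. Then every
inversion of \<open>b\<close> is paid for by \<open>e\<close>, by a far gap or by an exception.
\<close>
lemma few_inversions:
  assumes defect: "4000 * defect \<le> n" and nL: "quarter \<le> int nL" and nR: "quarter \<le> int nR" and b: "b \<in> B"
  shows "real (invL b) \<le> 2 * e + 25 * (real defect)\<^sup>2 / real n"
    and "real (invR b) \<le> 2 * e + 25 * (real defect)\<^sup>2 / real n"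
proof -
  have g0: "quarter \<ge> 0" and g4: "4 * quarter \<le> int n" by (auto simp: quarter_def)
  have n0: "n > 0" using n2 by simp
  have gm: "quarter + quarter \<le> m" using g4 g0 m_ge m_pos by linarith
  let ?S = "B \<inter> {quarter..quarter + quarter}"
  let ?farL = "(({tL..<mid} - A) \<inter> {tL + quarter..})" and ?farR = "(({mid..<tR} - A) \<inter> {..<tR - quarter})"
  let ?N = "{z \<in> uncovered. tR - quarter \<le> z \<and> z < tL + m + quarter}"
  have S: "5 * card ?S \<ge> n" using shifts_in_interval[of quarter] g0 gm defect by simp
  have "?S \<noteq> {}" using S n0 by (metis card.empty mult_0_right not_le)
  have "\<exists>c\<in>?S. card {z \<in> ?N. z - c \<notin> A} * card ?S \<le> defect * card ?N"
  proof (rule average_exists)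
    show "?S \<noteq> {}" by fact
    fix z assume "z \<in> ?N"
    thus "card {c \<in> ?S. z - c \<notin> A} \<le> defect"
      using g4 tR_eq int_missing by (intro misses_le) auto
  qed auto
  then obtain c where c: "c \<in> ?S" "card {z \<in> ?N. z - c \<notin> A} * card ?S \<le> defect * card ?N"
    by blast
  have "card {z \<in> ?N. z - c \<notin> A} * n \<le> card {z \<in> ?N. z - c \<notin> A} * (5 * card ?S)"
    using S by (rule mult_le_mono2)
  also have "\<dots> = 5 * (card {z \<in> ?N. z - c \<notin> A} * card ?S)" by simp
  also have "\<dots> \<le> 5 * (defect * card ?N)" using c(2) by (rule mult_le_mono2)
  also have "\<dots> \<le> 5 * (defect * card uncovered)" by (intro mult_le_mono2 card_mono) auto
  also have "\<dots> \<le> 5 * (defect * defect)" using card_uncovered_le by (intro mult_le_mono2)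
  finally have "real (card {z \<in> ?N. z - c \<notin> A} * n) \<le> real (5 * (defect * defect))"
    using of_nat_le_iff by blast
  hence N: "real (card {z \<in> ?N. z - c \<notin> A}) \<le> 5 * (real defect)\<^sup>2 / real n"
    using n0 by (simp add: field_simps power2_eq_square)
  have G: "card {z \<in> uncovered. z - b \<notin> A \<and> z - c \<notin> A} \<le> card {z \<in> ?N. z - c \<notin> A} + far_gaps"
  proof -
    have "{z \<in> uncovered. z - b \<notin> A \<and> z - c \<notin> A} \<subseteq> ({z \<in> ?N. z - c \<notin> A} \<union> (\<lambda>y. y + m) ` ?farL) \<union> ?farR"
    proof
      fix z assume z: "z \<in> {z \<in> uncovered. z - b \<notin> A \<and> z - c \<notin> A}"
      consider "z < tR - quarter" | "z \<ge> tL + m + quarter" | "tR - quarter \<le> z" "z < tL + m + quarter" by linarith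
      thus "z \<in> ({z \<in> ?N. z - c \<notin> A} \<union> (\<lambda>y. y + m) ` ?farL) \<union> ?farR"
      proof cases
        case 1 thus ?thesis using z g0 by (auto simp: uncovered_def)
      next
        case 2
        hence "z - m \<in> ?farL" using z g0 by (auto simp: uncovered_def)
        hence "z \<in> (\<lambda>y. y + m) ` ?farL" by (rule rev_image_eqI) simp
        thus ?thesis by blast
      next
        case 3 thus ?thesis using z by auto
      qed
    qed
    hence "card {z \<in> uncovered. z - b \<notin> A \<and> z - c \<notin> A} \<le> card (({z \<in> ?N. z - c \<notin> A} \<union> (\<lambda>y. y + m) ` ?farL) \<union> ?farR)"
      by (intro card_mono) auto
    also have "\<dots> \<le> card ({z \<in> ?N. z - c \<notin> A} \<union> (\<lambda>y. y + m) ` ?farL) + card ?farR"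
      by (rule card_Un_le)
    also have "card ({z \<in> ?N. z - c \<notin> A} \<union> (\<lambda>y. y + m) ` ?farL) \<le>
        card {z \<in> ?N. z - c \<notin> A} + card ((\<lambda>y. y + m) ` ?farL)"
      by (rule card_Un_le)
    also have "card ((\<lambda>y. y + m) ` ?farL) = card ?farL" by (simp add: card_image)
    finally show ?thesis by (simp add: far_gaps_def)
  qed
  have cB: "c \<in> B" using c by simp
  have G': "real (card {z \<in> uncovered. z - b \<notin> A \<and> z - c \<notin> A}) \<le> 5 * (real defect)\<^sup>2 / real n + real far_gaps"
    using of_nat_mono[OF G, where 'a = real] N by simp
  have sym: "{z \<in> uncovered. z - c \<notin> A \<and> z - b \<notin> A} = {z \<in> uncovered. z - b \<notin> A \<and> z - c \<notin> A}" by auto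
  note E1 = few_far_gaps[OF defect nL nR]
  have quot: "25 * (real defect)\<^sup>2 / real n = 20 * (real defect)\<^sup>2 / real n + 5 * (real defect)\<^sup>2 / real n"
    by (simp add: add_divide_distrib [symmetric])
  show "real (invL b) \<le> 2 * e + 25 * (real defect)\<^sup>2 / real n"
    using split_count[OF b cB] G' E1 of_nat_0_le_iff[of "invR c"] of_nat_0_le_iff[of missing] quot by linarith
  show "real (invR b) \<le> 2 * e + 25 * (real defect)\<^sup>2 / real n"
    using split_count[OF cB b] G' E1 of_nat_0_le_iff[of "invL c"] of_nat_0_le_iff[of missing] quot sym by simp
qed

text \<open>
The bounds of this section combine to \<open>defect \<le> 145 e + 1940 defect\<^sup>2/n\<close>, and the assumption on
\<open>defect\<close> allows the last term to be absorbed on the left.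
\<close>
lemma stability:
  assumes defect: "4000 * defect \<le> n" and nL: "quarter \<le> int nL" and nR: "quarter \<le> int nR"
  shows "real defect \<le> 290 * e" and "real missing \<le> e + 1682000 * e\<^sup>2 / real n"
proof -
  define \<tau> where "\<tau> = 2 * e + 25 * (real defect)\<^sup>2 / real n"
  have n0: "n > 0" using n2 by simp
  have \<tau>: "\<tau> \<ge> 0" using e_nonneg by (simp add: \<tau>_def)
  \<comment> \<open>the lemmas on inversions look at shifts up to \<open>8 u\<close>, all of which lie in \<open>{0..m}\<close> because \<open>u\<close> is
    tiny compared with \<open>n\<close>\<close>
  have sub: "card ({1..8 * int u} - S) \<le> missing" if "u \<le> defect" "\<And>b. b \<in> {1..8 * int u} - S \<Longrightarrow> f b \<in> {0..m} - B"
    "inj_on f {1..8 * int u}" for u S f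
  proof -
    have "card ({1..8 * int u} - S) \<le> card ({0..m} - B)"
      using that by (intro card_inj_on_le[of f]) (auto intro: inj_on_subset)
    thus ?thesis by (simp add: card_missing_shifts)
  qed
  have range: "8 * int u \<le> m" if "u \<le> defect" for u using that defect m_ge n2 by linarith
  have strayL: "real strayL \<le> 32 * \<tau> + 8 * real missing"
  proof -
    have "strayL \<le> defect" by (simp add: defect_def)
    show ?thesis
      using few_inversions_left(2)[OF finA, of mid B missing \<tau>, folded nL_def, folded tL_def, folded strayL_def]
        sub[OF \<open>strayL \<le> defect\<close>, of B id] range[OF \<open>strayL \<le> defect\<close>] few_inversions(1)[OF defect nL nR] \<tau>
      by (auto simp: invL_def \<tau>_def)
  qed
  have strayR: "real strayR \<le> 32 * \<tau> + 8 * real missing"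
  proof -
    have le: "strayR \<le> defect" by (simp add: defect_def)
    have inv: "real (card {s. s \<ge> mid \<and> s \<notin> A \<and> s + b \<in> A}) \<le> \<tau>" if "b \<in> {b. m - b \<in> B}" for b
      using few_inversions(2)[OF defect nL nR, of "m - b"] that by (simp add: invR_def \<tau>_def)
    have "card ({1..8 * int strayR} - {b. m - b \<in> B}) \<le> missing"
      using range[OF le] by (intro sub[OF le, of _ "\<lambda>b. m - b"]) (auto simp: inj_on_def)
    thus ?thesis
      using few_inversions_right(2)[OF finA, of mid "{b. m - b \<in> B}" missing \<tau>, folded nR_def, folded tR_def, folded strayR_def]
        inv \<tau> by auto
  qed
  have q_le: "real missing \<le> e + 20 * (real defect)\<^sup>2 / real n"
    using few_far_gaps[OF defect nL nR] of_nat_0_le_iff[of far_gaps] by linarith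
  define r where "r = (real defect)\<^sup>2 / real n"
  have r: "4000 * r \<le> real defect"
  proof -
    have "4000 * real defect \<le> real n" using defect by linarith
    hence "real defect * (4000 * real defect) \<le> real defect * real n" by (intro mult_left_mono) auto
    thus ?thesis using n0 by (simp add: r_def field_simps power2_eq_square)
  qed
  have "20 * (real defect)\<^sup>2 / real n = 20 * r" "\<tau> = 2 * e + 25 * r" by (simp_all add: r_def \<tau>_def)
  hence "real defect \<le> 145 * e + 1940 * r"
    using strayL strayR q_le unfolding defect_def[THEN arg_cong[of _ _ real]] of_nat_add by linarith
  thus v_le: "real defect \<le> 290 * e" using r by linarith
  have "(real defect)\<^sup>2 \<le> (290 * e)\<^sup>2" using v_le by (intro power_mono) auto
  hence "20 * (real defect)\<^sup>2 / real n \<le> 20 * (290 * e)\<^sup>2 / real n"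
    using n0 by (intro divide_right_mono mult_left_mono) auto
  thus "real missing \<le> e + 1682000 * e\<^sup>2 / real n"
    using q_le by (simp add: power_mult_distrib)
qed

lemma card_sym_diff_interval: "card (sym_diff A {tL..<tR}) \<le> 2 * defect"
proof -
  have "sym_diff A {tL..<tR} \<subseteq> (A \<inter> {..<tL} \<union> A \<inter> {tR..}) \<union> (({tL..<mid} - A) \<union> ({mid..<tR} - A))"
    by auto
  hence "card (sym_diff A {tL..<tR}) \<le>
      card ((A \<inter> {..<tL} \<union> A \<inter> {tR..}) \<union> (({tL..<mid} - A) \<union> ({mid..<tR} - A)))"
    using finA by (intro card_mono) auto
  also have "\<dots> \<le> card (A \<inter> {..<tL} \<union> A \<inter> {tR..}) + card (({tL..<mid} - A) \<union> ({mid..<tR} - A))"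
    by (rule card_Un_le)
  also have "\<dots> \<le> (strayL + strayR) + (strayL + strayR)"
    using card_Un_le[of "A \<inter> {..<tL}" "A \<inter> {tR..}"] card_Un_le[of "{tL..<mid} - A" "{mid..<tR} - A"]
    unfolding card_gaps_left card_gaps_right strayL_def[symmetric] strayR_def[symmetric] by linarith
  finally show ?thesis by (simp add: defect_def)
qed

end


section \<open>Exact and rough structure of A\<close>

lemma exists_cut:
  fixes A :: "int set"
  assumes "finite A" "j \<le> card A"
  shows "\<exists>c. card (A \<inter> {..<c}) = j"
  using assms
proof (induction "card A" arbitrary: A)
  case 0
  thus ?case by auto
next
  case (Suc N)
  hence ne: "A \<noteq> {}" by auto
  let ?M = "Max A"
  have M: "?M \<in> A" using Suc ne by simp
  have le: "x \<le> ?M" if "x \<in> A" for x using Suc that by simp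
  show ?case
  proof (cases "j = card A")
    case True
    have "A \<inter> {..<?M + 1} = A" using le by (auto simp: zless_add1_eq order_le_less)
    hence "card (A \<inter> {..<?M + 1}) = card A" by (rule arg_cong)
    thus ?thesis using True by blast
  next
    case False
    have "N = card (A - {?M})" using Suc.hyps(2) Suc.prems(1) M by simp
    moreover have "j \<le> card (A - {?M})" using False Suc.prems Suc.hyps(2) M by simp
    ultimately obtain c where c: "card ((A - {?M}) \<inter> {..<c}) = j"
      using Suc.hyps(1)[of "A - {?M}"] Suc.prems(1) by auto
    have lt: "x < ?M" if "x \<in> A" "x \<noteq> ?M" for x using le[OF that(1)] that(2) by linarith
    have "A \<inter> {..<min c ?M} = (A - {?M}) \<inter> {..<c}"
      by (auto intro: lt)
    thus ?thesis using c by metis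
  qed
qed

text \<open>
By counting, \<open>A + {0, n - 1}\<close> consists of the \<open>n\<close> integers from \<open>Min A\<close> on and of
\<open>A + (n - 1)\<close>. So for \<open>x\<close> in \<open>A\<close> above \<open>Min A\<close>, the sum \<open>x + (n -
2)\<close>, which lies in it, can only be \<open>(x - 1) + (n - 1)\<close> with \<open>x - 1\<close> in \<open>A\<close>.
\<close>
lemma interval_if_extremal:
  fixes A :: "int set" and n :: nat
  assumes finA: "finite A" and cardA: "card A = n" and n: "n \<ge> 2"
  defines "C \<equiv> A \<union> (\<lambda>a. a + (int n - 1)) ` A"
  assumes cardC: "card C \<le> 2 * n - 1"
    and closed: "\<And>a b. a \<in> A \<Longrightarrow> b \<in> {0..int n - 1} \<Longrightarrow> a + b \<in> C"
  shows "\<exists>t. A = {t..<t + int n}"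
proof -
  have ne: "A \<noteq> {}" using cardA n by auto
  define a where "a = Min A"
  have a: "a \<in> A" using finA ne by (simp add: a_def)
  have a_le: "a \<le> x" if "x \<in> A" for x using finA that by (simp add: a_def)
  let ?I = "{a..a + (int n - 1)}" and ?S = "(\<lambda>x. x + (int n - 1)) ` (A - {a})"
  have finC: "finite C" using finA by (simp add: C_def)
  have "x \<in> C" if "x \<in> ?I" for x using closed[OF a, of "x - a"] that by simp
  moreover have "?S \<subseteq> C" by (auto simp: C_def)
  ultimately have sub: "?I \<union> ?S \<subseteq> C" by blast
  have "x > a" if "x \<in> A - {a}" for x using a_le[of x] that by auto
  hence "?I \<inter> ?S = {}" by force
  hence "card (?I \<union> ?S) = card ?I + card ?S"
    using finA by (intro card_Un_disjoint) auto
  also have "card ?S = n - 1" using a cardA finA by (simp add: card_image)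
  also have "card ?I + (n - 1) = 2 * n - 1" using n by simp
  finally have eq: "?I \<union> ?S = C" using sub finC cardC by (intro card_seteq) auto
  have pred: "x - 1 \<in> A" if x: "x \<in> A" "x > a" for x
  proof (cases "x = a + 1")
    case True thus ?thesis using a by simp
  next
    case False
    have "x + (int n - 2) \<in> ?I \<union> ?S" unfolding eq using closed[OF x(1), of "int n - 2"] n by simp
    hence "x + (int n - 2) \<in> ?S" using False x by auto
    then obtain y where y: "y \<in> A - {a}" "x + (int n - 2) = y + (int n - 1)" by blast
    have "x - 1 = y" using y(2) by linarith
    thus ?thesis using y(1) by simp
  qed
  have down: "x - int i \<in> A" if "x \<in> A" "a \<le> x - int i" for x i
    using that
  proof (induction i)
    case (Suc i)
    hence "x - int i \<in> A" by simp
    hence "x - int i - 1 \<in> A" using pred[of "x - int i"] Suc.prems(2) by simp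
    thus ?case by (simp add: algebra_simps)
  qed simp
  have M: "Max A \<in> A" using finA ne by simp
  have "A = {a..Max A}"
  proof
    show "A \<subseteq> {a..Max A}" using a_le finA by auto
    show "{a..Max A} \<subseteq> A"
    proof
      fix x assume "x \<in> {a..Max A}"
      thus "x \<in> A" using down[OF M, of "nat (Max A - x)"] by simp
    qed
  qed
  hence "card A = card {a..Max A}" by (rule arg_cong)
  hence "Max A = a + int n - 1" using cardA n by simp
  hence "{a..Max A} = {a..<a + int n}" by auto
  with \<open>A = {a..Max A}\<close> have "A = {a..<a + int n}" by (rule trans)
  thus ?thesis by (rule exI)
qed

context shift_pair
begin

lemma new_elements_le:
  assumes b: "b \<in> B"
  shows "real (card {a \<in> A. a + b \<notin> A \<and> a + b - m \<notin> A}) \<le> real n - 1 - real num_occupied + e"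
proof -
  let ?F = "{a \<in> A. a + b \<notin> A \<and> a + b - m \<notin> A}"
  have disj: "(A + {0, m, 0, 0}) \<inter> (\<lambda>a. a + b) ` ?F = {}"
    by (auto simp: set_plus_def)
  have "card (A + {0, m, 0, 0}) + card ?F = card (A + {0, m, 0, 0}) + card ((\<lambda>a. a + b) ` ?F)"
    by (simp add: card_image)
  also have "\<dots> = card ((A + {0, m, 0, 0}) \<union> (\<lambda>a. a + b) ` ?F)"
    using finite_sumset[of 0 0] finA disj by (intro card_Un_disjoint [symmetric]) auto
  also have "\<dots> \<le> card (A + {0, m, b, b})"
    using finite_sumset[of b b] by (intro card_mono) (auto simp: set_plus_def)
  finally have "real (card (A + {0, m, 0, 0})) + real (card ?F) \<le> real (card (A + {0, m, b, b}))"
    by linarith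
  moreover have "real n + real num_occupied \<le> real (card (A + {0, m, 0, 0}))"
    using card_sumset_ge[of 0 0] by linarith
  ultimately show ?thesis using four[OF b b] by linarith
qed

text \<open>
Pairs at distance greater than \<open>m\<close>. Of the pairs at distance exactly \<open>m\<close>, only the increasing ones
count as bad: the differences allowed then form two periods, each of which represents every shift in \<open>{0..<m}\<close>
once.
\<close>
definition bad_pairs :: "(int \<times> int) set" where
  "bad_pairs = {(x, y) \<in> A \<times> A. \<not> (- m \<le> y - x \<and> y - x < m)}"

lemma finite_bad_pairs: "finite bad_pairs"
  by (rule finite_subset[of _ "A \<times> A"]) (auto simp: bad_pairs_def finA)

text \<open>
If \<open>a + b\<close> lies in \<open>A\<close> or in \<open>A + m\<close>, then \<open>a\<close> and one of \<open>a +
b\<close>, \<open>a + b - m\<close> form a pair of elements of \<open>A\<close> that is not bad, and \<open>b\<close> can be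
read off from it.
\<close>
lemma card_bad_pairs_le:
  "real (card bad_pairs) \<le> real n + (real n - 1) * (real n - 1 - real num_occupied + e)"
proof -
  let ?B0 = "B - {m}"
  let ?G = "{(x, y) \<in> A \<times> A. - m \<le> y - x \<and> y - x < m}"
  let ?P = "SIGMA b:?B0. {a \<in> A. \<not> (a + b \<notin> A \<and> a + b - m \<notin> A)}"
  let ?L = "real n - 1 - real num_occupied + e"
  have "card bad_pairs + card ?G = card (bad_pairs \<union> ?G)"
    using finA by (intro card_Un_disjoint [symmetric] finite_bad_pairs)
      (auto simp: bad_pairs_def intro: finite_subset[of _ "A \<times> A"])
  also have "bad_pairs \<union> ?G = A \<times> A" by (auto simp: bad_pairs_def)
  finally have tot: "real (card bad_pairs) + real (card ?G) = real n * real n"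
    by (simp add: card_cartesian_product cardA flip: of_nat_add of_nat_mult)
  have "card ?P \<le> card ?G"
  proof (rule card_inj_on_le)
    \<comment> \<open>the sign of the difference tells which of the two alternatives was taken\<close>
    let ?f = "\<lambda>(b, a). (a, if a + b \<in> A then a + b else a + b - m)"
    have b: "0 \<le> b \<and> b < m" if "b \<in> ?B0" for b using B0_sub that by auto
    show "inj_on ?f ?P"
    proof (rule inj_onI)
      fix x y assume x: "x \<in> ?P" and y: "y \<in> ?P" and eq: "?f x = ?f y"
      obtain b1 a1 where x1: "x = (b1, a1)" by (cases x)
      obtain b2 a2 where y2: "y = (b2, a2)" by (cases y)
      have "a1 = a2 \<and> (b1 = b2 \<or> b1 = b2 + m \<or> b1 + m = b2)"
        using eq by (auto simp: x1 y2 split: if_splits)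
      moreover have "0 \<le> b1 \<and> b1 < m" "0 \<le> b2 \<and> b2 < m" using b x y by (auto simp: x1 y2)
      ultimately show "x = y" unfolding x1 y2 by auto
    qed
    show "?f ` ?P \<subseteq> ?G" using b by (force split: if_splits)
    show "finite ?G" using finA by (auto intro: finite_subset[of _ "A \<times> A"])
  qed
  moreover have "card ?P = (\<Sum>b\<in>?B0. card {a \<in> A. \<not> (a + b \<notin> A \<and> a + b - m \<notin> A)})"
    using finB finA by (intro card_SigmaI) auto
  moreover have "real n - ?L \<le> real (card {a \<in> A. \<not> (a + b \<notin> A \<and> a + b - m \<notin> A)})" if "b \<in> ?B0" for b
  proof -
    have "card A = card {a \<in> A. a + b \<notin> A \<and> a + b - m \<notin> A} + card {a \<in> A. \<not> (a + b \<notin> A \<and> a + b - m \<notin> A)}"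
      using finA by (subst card_Un_disjoint [symmetric]) (auto intro!: arg_cong[of _ _ card])
    thus ?thesis using new_elements_le[of b] that cardA by simp
  qed
  hence "(\<Sum>b\<in>?B0. real n - ?L) \<le> (\<Sum>b\<in>?B0. real (card {a \<in> A. \<not> (a + b \<notin> A \<and> a + b - m \<notin> A)}))"
    by (intro sum_mono)
  ultimately have "real (card ?B0) * (real n - ?L) \<le> real (card ?G)"
    by (simp flip: of_nat_sum)
  moreover have "real (card ?B0) = real n - 1" using card_B0 n2 by (simp add: of_nat_diff)
  ultimately have "(real n - 1) * (real n - ?L) \<le> real (card ?G)" by simp
  hence "real (card bad_pairs) \<le> real n * real n - (real n - 1) * (real n - ?L)" using tot by linarith
  also have "\<dots> = real n + (real n - 1) * ?L" by (simp add: algebra_simps)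
  finally show ?thesis .
qed

text \<open>
With error terms below one, \<open>B\<close> is all of \<open>{0..m}\<close>, every residue class is occupied, and no shift
leads outside \<open>A + {0, m}\<close>, which has at most \<open>2 n - 1\<close> elements.
\<close>
lemma extremal_case:
  assumes e: "e < 1" and num_occupied: "real n - 1 \<le> real num_occupied" and m: "real_of_int m < real n"
  shows "m + 1 = int n" and "\<exists>t. A = {t..<t + int n}"
proof -
  have m: "m = int n - 1" using m m_ge by linarith
  thus "m + 1 = int n" by simp
  have "B = {0..m}" using Bsub cardB m n2 by (intro card_subset_eq) auto
  hence B: "b \<in> B" if "b \<in> {0..int n - 1}" for b using that m by simp
  have kn: "real n - 1 - real num_occupied + e < 1" using e num_occupied by linarith
  show "\<exists>t. A = {t..<t + int n}"
  proof (rule interval_if_extremal[OF finA cardA n2])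
    have "A \<union> (\<lambda>a. a + (int n - 1)) ` A \<subseteq> A + {0, m, 0, 0}"
      using m by (auto simp: set_plus_def intro: bexI[of _ 0])
    hence "card (A \<union> (\<lambda>a. a + (int n - 1)) ` A) \<le> card (A + {0, m, 0, 0})"
      using finite_sumset by (intro card_mono)
    thus "card (A \<union> (\<lambda>a. a + (int n - 1)) ` A) \<le> 2 * n - 1"
      using four[OF zeroB zeroB] e n2 by linarith
    fix a b assume a: "a \<in> A" and b: "b \<in> {0..int n - 1}"
    have "card {a \<in> A. a + b \<notin> A \<and> a + b - m \<notin> A} = 0"
      using new_elements_le[OF B[OF b]] kn by linarith
    hence "{a \<in> A. a + b \<notin> A \<and> a + b - m \<notin> A} = {}" using finA by simp
    hence "a + b \<in> A \<or> a + b - m \<in> A" using a by blast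
    thus "a + b \<in> A \<union> (\<lambda>a. a + (int n - 1)) ` A"
    proof
      assume "a + b - m \<in> A"
      hence "a + b \<in> (\<lambda>a. a + (int n - 1)) ` A" using m by (intro image_eqI[of _ _ "a + b - m"]) auto
      thus ?thesis by blast
    qed blast
  qed
qed

end

context split_shift_pair
begin

lemma far_left_le: "card {a \<in> A. a \<le> mid - m} * nR \<le> card bad_pairs"
proof -
  have "card ({a \<in> A. a \<le> mid - m} \<times> (A \<inter> {mid..})) \<le> card bad_pairs"
    by (rule card_mono[OF finite_bad_pairs]) (auto simp: bad_pairs_def)
  thus ?thesis by (simp add: card_cartesian_product nR_def)
qed

lemma far_right_le: "card {a \<in> A. a \<ge> mid + m} * nL \<le> card bad_pairs"
proof -
  have "card ({a \<in> A. a \<ge> mid + m} \<times> (A \<inter> {..<mid})) \<le> card bad_pairs"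
    by (rule card_mono[OF finite_bad_pairs]) (auto simp: bad_pairs_def)
  thus ?thesis by (simp add: card_cartesian_product nL_def)
qed

text \<open>
Let \<open>Y\<close> consist of gaps in distinct residue classes whose elements of \<open>A\<close>, if any, are forced to
lie one period away at \<open>y + \<sigma>\<close>, apart from elements of \<open>A\<close> at distance \<open>m\<close> or
more from the cut. Then most \<open>y + \<sigma>\<close> are in \<open>A\<close>, and they form bad pairs with all of
\<open>X\<close>.
\<close>
lemma crude_defect:
  assumes X: "X \<subseteq> A" and Y: "Y \<subseteq> {c..<c + m}"
    and alt: "\<And>y a. y \<in> Y \<Longrightarrow> a \<in> A \<Longrightarrow> a mod m = y mod m \<Longrightarrow>
        a = y + \<sigma> \<or> a \<le> mid - m \<or> a \<ge> mid + m"
    and far: "\<And>x y. x \<in> X \<Longrightarrow> y \<in> Y \<Longrightarrow> \<bar>y + \<sigma> - x\<bar> > m"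
  shows "real (card X) * (real (card Y) - (real (card vacant) + real (card {a \<in> A. a \<le> mid - m})
      + real (card {a \<in> A. a \<ge> mid + m}))) \<le> real (card bad_pairs)"
proof -
  let ?N1 = "{a \<in> A. a \<le> mid - m}" and ?N2 = "{a \<in> A. a \<ge> mid + m}"
  let ?Y1 = "{y \<in> Y. y + \<sigma> \<in> A}"
  have finY: "finite Y" using Y finite_subset by blast
  have "card (Y - ?Y1) \<le> card (vacant \<union> (\<lambda>a. a mod m) ` (?N1 \<union> ?N2))"
  proof (rule card_inj_on_le)
    show "inj_on (\<lambda>y. y mod m) (Y - ?Y1)"
    proof (rule inj_onI)
      fix x y assume "x \<in> Y - ?Y1" "y \<in> Y - ?Y1" "x mod m = y mod m"
      hence "(x - c) mod m = (y - c) mod m" by (metis mod_diff_left_eq)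
      moreover have "x - c \<in> {0..<m}" "y - c \<in> {0..<m}" using \<open>x \<in> Y - ?Y1\<close> \<open>y \<in> Y - ?Y1\<close> Y by auto
      ultimately show "x = y" by simp
    qed
    show "(\<lambda>y. y mod m) ` (Y - ?Y1) \<subseteq> vacant \<union> (\<lambda>a. a mod m) ` (?N1 \<union> ?N2)"
    proof (rule image_subsetI)
      fix y assume y: "y \<in> Y - ?Y1"
      show "y mod m \<in> vacant \<union> (\<lambda>a. a mod m) ` (?N1 \<union> ?N2)"
      proof (cases "fibre y = 0")
        case True thus ?thesis using m_pos by (simp add: vacant_def)
      next
        case False
        hence "{a \<in> A. a mod m = y mod m} \<noteq> {}" unfolding fibre_def by (metis card.empty)
        then obtain a where a: "a \<in> A" "a mod m = y mod m" by blast
        hence "a \<in> ?N1 \<union> ?N2" using alt[of y a] y by auto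
        hence "a mod m \<in> (\<lambda>a. a mod m) ` (?N1 \<union> ?N2)" by (rule imageI)
        thus ?thesis using a by simp
      qed
    qed
  qed (use finA in auto)
  also have "\<dots> \<le> card vacant + card ((\<lambda>a. a mod m) ` (?N1 \<union> ?N2))" by (rule card_Un_le)
  also have "card ((\<lambda>a. a mod m) ` (?N1 \<union> ?N2)) \<le> card (?N1 \<union> ?N2)"
    using finA by (intro card_image_le) auto
  also have "card (?N1 \<union> ?N2) \<le> card ?N1 + card ?N2" by (rule card_Un_le)
  finally have "card (Y - ?Y1) \<le> card vacant + (card ?N1 + card ?N2)" by simp
  moreover have "card Y = card ?Y1 + card (Y - ?Y1)"
  proof -
    have "card Y = card (?Y1 \<union> (Y - ?Y1))" by (rule arg_cong) auto
    also have "\<dots> = card ?Y1 + card (Y - ?Y1)" using finY by (intro card_Un_disjoint) auto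
    finally show ?thesis .
  qed
  ultimately have Y1: "real (card Y) - (real (card vacant) + real (card ?N1) + real (card ?N2)) \<le> real (card ?Y1)"
    by linarith
  have "card (X \<times> ?Y1) \<le> card bad_pairs"
  proof (rule card_inj_on_le[OF _ _ finite_bad_pairs])
    show "inj_on (\<lambda>(x, y). (x, y + \<sigma>)) (X \<times> ?Y1)" by (auto simp: inj_on_def)
    show "(\<lambda>(x, y). (x, y + \<sigma>)) ` (X \<times> ?Y1) \<subseteq> bad_pairs"
    proof (clarify)
      fix x y assume xy: "x \<in> X" "y \<in> Y" "y + \<sigma> \<in> A"
      thus "(x, y + \<sigma>) \<in> bad_pairs" using far[OF xy(1,2)] X by (auto simp: bad_pairs_def)
    qed
  qed
  hence "real (card X) * real (card ?Y1) \<le> real (card bad_pairs)"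
    by (simp add: card_cartesian_product flip: of_nat_mult)
  moreover have "real (card X) * (real (card Y) - (real (card vacant) + real (card ?N1) + real (card ?N2)))
      \<le> real (card X) * real (card ?Y1)"
    using Y1 by (intro mult_left_mono) auto
  ultimately show ?thesis by linarith
qed

lemma congruent_far:
  assumes "a mod m = y mod m" "a \<noteq> y"
  shows "a = y + m \<or> a = y - m \<or> a \<ge> y + 2 * m \<or> a \<le> y - 2 * m"
proof -
  have "m dvd a - y" using assms(1) by (simp add: mod_eq_dvd_iff)
  then obtain z where z: "a - y = m * z" by (elim dvdE)
  have "z \<noteq> 0" using z assms(2) by auto
  then consider "z = 1" | "z = -1" | "z \<ge> 2" | "z \<le> -2" by linarith
  thus ?thesis
  proof cases
    case 3
    hence "m * 2 \<le> m * z" using m_pos by (intro mult_left_mono) auto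
    thus ?thesis using z by linarith
  next
    case 4
    hence "m * z \<le> m * (-2)" using m_pos by (intro mult_left_mono) auto
    thus ?thesis using z by linarith
  qed (use z in auto)
qed

text \<open>
With few bad pairs, few elements of \<open>A\<close> are at distance \<open>m\<close> or more from the median. For the stray
elements on one side and the equally many gaps on that side, \<open>crude_defect\<close> then gives almost
\<open>u\<^sup>2\<close> bad pairs, whereas there are at most \<open>6 n\<^sup>2/10\<^sup>1\<^sup>0\<close>. The threshold
for \<open>n\<close> absorbs the linear term in \<open>card_bad_pairs_le\<close>.
\<close>
lemma crude_stability:
  assumes p: "real n - 1 - real num_occupied \<le> (real n - 1) * (5 / 10 ^ 11)"
    and m: "real_of_int m \<le> (real n - 1) * (1 + 4 / 10 ^ 10)"
    and e: "e \<le> (real n - 1) * (2 / 10 ^ 22)"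
    and large: "n \<ge> 2000000000" and mid: "nL = n div 2"
  shows "4000 * defect \<le> n"
proof -
  define N where "N = real n"
  have N: "N \<ge> 2000000000" using large by (simp add: N_def)
  define D where "D = real (card bad_pairs)"
  have sub: "real n - 1 \<le> N" "real n - 1 \<ge> 0" using N by (auto simp: N_def)
  have p': "real n - 1 - real num_occupied \<le> N / 20000000000"
    using p sub by simp
  have e': "e \<le> N / 5000000000000000000000" using e sub by simp
  have m': "real_of_int m \<le> N - 1 + N / 2500000000" using m by (simp add: N_def algebra_simps)
  have L: "real n - 1 - real num_occupied + e \<le> N / 10000000000" using p' e' N by linarith
  have L0: "real n - 1 - real num_occupied + e \<ge> 0"
    using inflow_le[OF zeroB] of_nat_0_le_iff[of "inflow 0"] by linarith
  have D: "D \<le> N * N * (6 / 10000000000)"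
  proof -
    have "D \<le> N + (real n - 1) * (real n - 1 - real num_occupied + e)"
      using card_bad_pairs_le by (simp add: D_def N_def)
    moreover have "(real n - 1) * (real n - 1 - real num_occupied + e) \<le> N * (N / 10000000000)"
      using L L0 sub N by (intro mult_mono) auto
    moreover have "N * 2000000000 \<le> N * N" using N by (intro mult_left_mono) auto
    ultimately show ?thesis by simp
  qed
  have nL: "real nL \<ge> N * (49 / 100)" and nR: "real nR \<ge> N * (49 / 100)"
  proof -
    have "2 * real nL \<ge> N - 1" unfolding mid N_def by linarith
    thus "real nL \<ge> N * (49 / 100)" using N by simp
    have "2 * nR \<ge> n" using mid n_split by linarith
    thus "real nR \<ge> N * (49 / 100)" unfolding N_def by linarith
  qed
  have nLm: "int nL \<le> m" and nRm: "int nR \<le> m" using mid n_split m_ge n2 large by linarith+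
  have quot: "real x \<le> N * (13 / 10000000000)" if "x * y \<le> card bad_pairs" "real y \<ge> N * (49 / 100)" for x y :: nat
  proof -
    have "real x * (N * (49 / 100)) \<le> real x * real y" using that by (intro mult_left_mono) auto
    also have "\<dots> \<le> D" using that(1) unfolding D_def of_nat_mult [symmetric] of_nat_le_iff .
    also have "\<dots> \<le> N * N * (6 / 10000000000)" by (rule D)
    also have "\<dots> \<le> (N * (13 / 10000000000)) * (N * (49 / 100))" using N by simp
    finally show ?thesis using N by (simp add: mult_le_cancel_right)
  qed
  \<comment> \<open>each half of \<open>A\<close> contains nearly \<open>n/2\<close> elements, with all of which a distant element of the other
    half forms a bad pair\<close>
  have f1: "real (card {a \<in> A. a \<le> mid - m}) \<le> N * (13 / 10000000000)"
    by (rule quot[OF far_left_le nR])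
  have f2: "real (card {a \<in> A. a \<ge> mid + m}) \<le> N * (13 / 10000000000)"
    by (rule quot[OF far_right_le nL])
  have "real num_occupied + real (card vacant) = real_of_int m" using num_occupied_plus_vacant by linarith
  hence h: "real (card vacant) \<le> N * (5 / 10000000000)"
    using m' p' by (simp add: N_def)
  have bound: "9000 * u \<le> n"
    if "card X = u" "card Y = u" and crude: "real (card X) * (real (card Y) - (real (card vacant)
      + real (card {a \<in> A. a \<le> mid - m}) + real (card {a \<in> A. a \<ge> mid + m}))) \<le> real (card bad_pairs)"
    for u and X Y :: "int set"
  proof (rule ccontr)
    assume "\<not> 9000 * u \<le> n"
    hence u: "real u > N / 9000" unfolding N_def by linarith
    have "(N / 9000) * (N / 10000) \<le> real u * (real u - (real (card vacant)
        + real (card {a \<in> A. a \<le> mid - m}) + real (card {a \<in> A. a \<ge> mid + m})))"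
      using u f1 f2 h N by (intro mult_mono) auto
    also have "\<dots> \<le> N * N * (6 / 10000000000)" using crude D that(1,2) by (simp add: D_def)
    finally have "N * N \<le> 0" by simp
    thus False using N by (simp add: mult_le_0_iff)
  qed
  have "9000 * strayL \<le> n"
  proof (rule bound)
    show "card (A \<inter> {..<tL}) = strayL" by (simp add: strayL_def)
    show "card ({tL..<mid} - A) = strayL" by (rule card_gaps_left)
    show "real (card (A \<inter> {..<tL})) * (real (card ({tL..<mid} - A)) - (real (card vacant)
      + real (card {a \<in> A. a \<le> mid - m}) + real (card {a \<in> A. a \<ge> mid + m}))) \<le> real (card bad_pairs)"
    proof (rule crude_defect[where c = tL and \<sigma> = m])
      show "{tL..<mid} - A \<subseteq> {tL..<tL + m}" using nLm by (auto simp: tL_def)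
      fix y a assume y: "y \<in> {tL..<mid} - A" and a: "a \<in> A" "a mod m = y mod m"
      hence "a \<noteq> y" by auto
      from congruent_far[OF a(2) this] show "a = y + m \<or> a \<le> mid - m \<or> a \<ge> mid + m"
        using y nLm m_pos by (auto simp: tL_def)
    qed (use m_pos in auto)
  qed
  moreover have "9000 * strayR \<le> n"
  proof (rule bound)
    show "card (A \<inter> {tR..}) = strayR" by (simp add: strayR_def)
    show "card ({mid..<tR} - A) = strayR" by (rule card_gaps_right)
    show "real (card (A \<inter> {tR..})) * (real (card ({mid..<tR} - A)) - (real (card vacant)
      + real (card {a \<in> A. a \<le> mid - m}) + real (card {a \<in> A. a \<ge> mid + m}))) \<le> real (card bad_pairs)"
    proof (rule crude_defect[where c = mid and \<sigma> = "- m"])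
      show "{mid..<tR} - A \<subseteq> {mid..<mid + m}" using nRm by (auto simp: tR_def)
      fix y a assume y: "y \<in> {mid..<tR} - A" and a: "a \<in> A" "a mod m = y mod m"
      hence "a \<noteq> y" by auto
      from congruent_far[OF a(2) this] show "a = y + - m \<or> a \<le> mid - m \<or> a \<ge> mid + m"
        using y nRm m_pos by (auto simp: tR_def)
    qed (use m_pos in auto)
  qed
  moreover have "missing * 18000000 \<le> n"
  proof -
    have "real missing = real_of_int m + 1 - real n" using int_missing by linarith
    hence "real missing * 18000000 \<le> N" using m' N by (simp add: N_def)
    thus ?thesis unfolding N_def by linarith
  qed
  ultimately show ?thesis by (simp add: defect_def)
qed

end

context shift_pair
begin

text \<open>
For \<open>n\<close> below \<open>2 * 10\<^sup>9\<close>, the estimate for \<open>m\<close> leaves less than one unit of room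
and the extremal case applies; beyond that threshold a median cut is stable.
\<close>
theorem normalised_stability:
  assumes gcd: "Gcd B = 1" and e: "e \<le> (real n - 1) * (2 / 10 ^ 22)"
  shows "real_of_int m + 1 \<le> real n + e + 1682000 * e\<^sup>2 / real n"
    and "\<exists>t. real (card (sym_diff A {t..<t + int n})) \<le> 580 * e"
proof -
  note km = near_extremal_modulus[OF gcd e]
  have "real_of_int m + 1 \<le> real n + e + 1682000 * e\<^sup>2 / real n \<and>
    (\<exists>t. real (card (sym_diff A {t..<t + int n})) \<le> 580 * e)"
  proof (cases "n \<ge> 2000000000")
    case True
    have "n div 2 \<le> card A" by (simp add: cardA)
    then obtain mid where mid: "card (A \<inter> {..<mid}) = n div 2" using exists_cut[OF finA] by blast
    interpret split_shift_pair A B m n e mid ..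
    have nL: "nL = n div 2" using mid by (simp add: nL_def)
    have defect: "4000 * defect \<le> n" by (rule crude_stability[OF km e True nL])
    have quarter: "quarter \<le> int nL" "quarter \<le> int nR" using nL n_split by (auto simp: quarter_def)
    note st = stability[OF defect quarter]
    have "real (card (sym_diff A {tL..<tL + int n})) \<le> 2 * real defect"
      using card_sym_diff_interval unfolding tR_eq by linarith
    hence "real (card (sym_diff A {tL..<tL + int n})) \<le> 580 * e" using st(1) by linarith
    moreover have "real_of_int m + 1 = real n + real missing" using int_missing by linarith
    ultimately show ?thesis using st(2) by auto
  next
    case False
    hence n: "real n - 1 \<le> 2000000000" by linarith
    have "e < 1" using e n by simp
    moreover have "real n - 1 \<le> real num_occupied"
    proof -
      have "real n < real (num_occupied + 2)" using km(1) n by simp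
      hence "n < num_occupied + 2" by (simp only: of_nat_less_iff)
      thus ?thesis by linarith
    qed
    moreover have "real_of_int m < real n" using km(2) n by simp
    ultimately have ex: "m + 1 = int n" "\<exists>t. A = {t..<t + int n}" by (rule extremal_case)+
    then obtain t where t: "A = {t..<t + int n}" by blast
    have "real (card (sym_diff A {t..<t + int n})) \<le> 580 * e"
      using e_nonneg by (simp flip: t)
    moreover have "real_of_int m + 1 = real n" using ex(1) by linarith
    moreover have "e\<^sup>2 / real n \<ge> 0" by simp
    ultimately show ?thesis using e_nonneg by auto
  qed
  thus "real_of_int m + 1 \<le> real n + e + 1682000 * e\<^sup>2 / real n"
    and "\<exists>t. real (card (sym_diff A {t..<t + int n})) \<le> 580 * e" by blast+
qed

end


section \<open>Reduction to the normalised situation\<close>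

lemma card_sym_diff_eq:
  assumes "finite A" "finite B"
  shows "card (sym_diff A B) + 2 * card (A \<inter> B) = card A + card B"
proof -
  have "card (sym_diff A B) = card (A - B) + card (B - A)"
    using assms by (intro card_Un_disjoint) auto
  thus ?thesis using card_Int_Diff[OF assms(1), of B] card_Int_Diff[OF assms(2), of A]
    by (simp add: Int_commute)
qed

text \<open>
After translation \<open>B\<close> consists of multiples of its greatest common divisor \<open>D\<close>, whereas
\<open>A\<close> may meet several classes modulo \<open>D\<close>. The map \<open>\<phi>\<close> divides by \<open>D\<close>
in each class and places the classes far apart; it turns the shifts by elements of \<open>B\<close> into shifts by their
quotients, so sumsets do not grow. An interval of length \<open>N\<close> meets the image of only one class, hence it pulls
back to a progression with difference \<open>D\<close>.
\<close>
lemma arith_prog_stability: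
  fixes A B :: "int set" and n :: nat and \<epsilon> :: real
  assumes finA: "finite A" and finB: "finite B" and cardA: "card A = n" and cardB: "card B = n"
    and n: "n \<ge> 2" and \<epsilon>: "\<epsilon> < 1 / 10 ^ 22"
    and four: "\<And>b1 b2 b3 b4. b1 \<in> B \<Longrightarrow> b2 \<in> B \<Longrightarrow> b3 \<in> B \<Longrightarrow> b4 \<in> B \<Longrightarrow>
      real (card (A + {b1, b2, b3, b4})) \<le> (2 + \<epsilon>) * real n - 1"
  shows "\<exists>P Q d N. int N = \<lfloor>(1 + \<epsilon> + 2000000 * \<epsilon>\<^sup>2) * real n\<rfloor> \<and>
          is_arith_prog d N P \<and> is_arith_prog d N Q \<and>
          B \<subseteq> Q \<and> real (card (sym_diff A P)) \<le> 2000000 * \<epsilon> * real n"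
proof -
  define N where "N = nat \<lfloor>(1 + \<epsilon> + 2000000 * \<epsilon>\<^sup>2) * real n\<rfloor>"
  have neB: "B \<noteq> {}" using cardB n by auto
  define b0 where "b0 = Min B"
  define b1 where "b1 = Max B"
  have b0: "b0 \<in> B" "\<And>b. b \<in> B \<Longrightarrow> b0 \<le> b" and b1: "b1 \<in> B" "\<And>b. b \<in> B \<Longrightarrow> b \<le> b1"
    using finB neB by (simp_all add: b0_def b1_def)
  define D where "D = Gcd ((\<lambda>b. b - b0) ` B)"
  have dvd: "D dvd b - b0" if "b \<in> B" for b
    unfolding D_def using that by (intro Gcd_dvd imageI)
  have D: "D > 0"
  proof -
    have "b0 \<noteq> b1"
    proof
      assume "b0 = b1"
      hence "B \<subseteq> {b0}" using b0(2) b1(2) by force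
      hence "card B \<le> 1" using card_mono[of "{b0}" B] by simp
      thus False using cardB n by simp
    qed
    hence "D \<noteq> 0" using dvd[OF b1(1)] by auto
    thus ?thesis unfolding D_def using Gcd_int_greater_eq_0 by (simp add: order_less_le)
  qed
  define \<beta> where "\<beta> b = (b - b0) div D" for b
  have \<beta>: "b - b0 = D * \<beta> b" if "b \<in> B" for b
    using dvd[OF that] by (simp add: \<beta>_def)
  have \<beta>_mono: "\<beta> b \<le> \<beta> b'" if "b \<le> b'" for b b'
    using that D by (simp add: \<beta>_def zdiv_mono1)
  have \<beta>0: "\<beta> b0 = 0" by (simp add: \<beta>_def)
  have inj\<beta>: "inj_on \<beta> B"
  proof (rule inj_onI)
    fix x y assume "x \<in> B" "y \<in> B" "\<beta> x = \<beta> y"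
    thus "x = y" using \<beta>[of x] \<beta>[of y] by simp
  qed
  define m where "m = \<beta> b1"
  obtain R where R: "\<bar>x div D\<bar> \<le> R" if "x \<in> A" for x
  proof
    show "\<bar>x div D\<bar> \<le> (\<Sum>x\<in>A. \<bar>x div D\<bar>)" if "x \<in> A" for x
      using finA that by (intro member_le_sum) auto
  qed
  have R0: "R \<ge> 0"
  proof -
    obtain a where "a \<in> A" using cardA n by (metis card.empty ex_in_conv not_numeral_le_zero)
    thus ?thesis using R[of a] by linarith
  qed
  \<comment> \<open>large enough that images of different classes differ by more than \<open>N\<close>\<close>
  define M where "M = 2 * R + int N + 1"
  define \<phi> where "\<phi> x = x div D + (x mod D) * M" for x
  have same_class: "x mod D = y mod D" if "x \<in> A" "y \<in> A" "\<bar>\<phi> x - \<phi> y\<bar> \<le> int N" for x y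
  proof (rule ccontr)
    assume "x mod D \<noteq> y mod D"
    hence "1 * M \<le> \<bar>x mod D - y mod D\<bar> * M"
      using R0 by (intro mult_right_mono) (auto simp: M_def)
    also have "\<dots> = \<bar>(x mod D - y mod D) * M\<bar>" using R0 by (simp add: abs_mult M_def)
    also have "(x mod D - y mod D) * M = (\<phi> x - \<phi> y) - (x div D - y div D)"
      by (simp add: \<phi>_def algebra_simps)
    finally have "M \<le> \<bar>(\<phi> x - \<phi> y) - (x div D - y div D)\<bar>" by simp
    thus False using R[OF that(1)] R[OF that(2)] that(3) unfolding M_def by linarith
  qed
  have inj\<phi>: "inj_on \<phi> A"
  proof (rule inj_onI)
    fix x y assume xy: "x \<in> A" "y \<in> A" "\<phi> x = \<phi> y"
    hence "x mod D = y mod D" using same_class[of x y] by simp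
    moreover from this have "x div D = y div D" using xy(3) by (simp add: \<phi>_def)
    ultimately show "x = y" by (metis div_mult_mod_eq)
  qed
  have shift\<phi>: "\<phi> (x + c - b0) = \<phi> x + \<beta> c" if "c \<in> B" for x c
  proof -
    have eq: "x + c - b0 = x + D * \<beta> c" using \<beta>[OF that] by simp
    show ?thesis unfolding eq \<phi>_def using D by simp
  qed
  interpret S: shift_pair "\<phi> ` A" "\<beta> ` B" m n "\<epsilon> * real n"
  proof
    show "card (\<phi> ` A) = n" "card (\<beta> ` B) = n" using inj\<phi> inj\<beta> cardA cardB by (simp_all add: card_image)
    show "0 \<in> \<beta> ` B" using b0(1) \<beta>0 by (metis imageI)
    show "m \<in> \<beta> ` B" using b1 by (simp add: m_def)
    show "\<beta> ` B \<subseteq> {0..m}" using b0(2) b1(2) \<beta>_mono \<beta>0 by (force simp: m_def)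
    fix x y assume "x \<in> \<beta> ` B" "y \<in> \<beta> ` B"
    then obtain b b' where b: "b \<in> B" "b' \<in> B" "x = \<beta> b" "y = \<beta> b'" by blast
    have "\<phi> ` A + {0, m, x, y} \<subseteq> (\<lambda>z. \<phi> (z - b0)) ` (A + {b0, b1, b, b'})"
    proof
      fix z assume "z \<in> \<phi> ` A + {0, m, x, y}"
      then obtain a s where a: "a \<in> A" "s \<in> {0, m, x, y}" "z = \<phi> a + s" by (auto elim!: set_plus_elim)
      have "{0, m, x, y} = \<beta> ` {b0, b1, b, b'}" by (simp add: b m_def \<beta>0)
      then obtain c where c: "c \<in> {b0, b1, b, b'}" "s = \<beta> c" using a(2) by blast
      hence "c \<in> B" using b b0 b1 by blast
      hence "z = \<phi> (a + c - b0)" using shift\<phi> a c by simp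
      moreover have "a + c \<in> A + {b0, b1, b, b'}" using a(1) c(1) by (rule set_plus_intro)
      ultimately show "z \<in> (\<lambda>z. \<phi> (z - b0)) ` (A + {b0, b1, b, b'})" by blast
    qed
    hence "card (\<phi> ` A + {0, m, x, y}) \<le> card (A + {b0, b1, b, b'})"
      using finA by (intro surj_card_le finite_set_plus) auto
    hence "real (card (\<phi> ` A + {0, m, x, y})) \<le> real (card (A + {b0, b1, b, b'}))" by simp
    also have "\<dots> \<le> (2 + \<epsilon>) * real n - 1" using b b0 b1 by (intro four) auto
    finally show "real (card (\<phi> ` A + {0, m, x, y})) \<le> 2 * real n - 1 + \<epsilon> * real n"
      by (simp add: algebra_simps)
  qed (use finA finB n in auto)
  have \<epsilon>0: "\<epsilon> \<ge> 0" using S.e_nonneg n by (simp add: zero_le_mult_iff)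
  have gcd: "Gcd (\<beta> ` B) = 1"
  proof -
    have "(\<lambda>b. b - b0) ` B = (*) D ` (\<beta> ` B)" unfolding image_image using \<beta> by (intro image_cong) auto
    hence "D = D * Gcd (\<beta> ` B)" unfolding D_def[symmetric]
      using D by (metis D_def Gcd_mult abs_mult abs_of_pos normalize_int_def abs_Gcd_eq)
    thus ?thesis using D by simp
  qed
  have e: "\<epsilon> * real n \<le> (real n - 1) * (2 / 10 ^ 22)"
  proof -
    have "\<epsilon> * real n \<le> (1 / 10 ^ 22) * real n" using \<epsilon> by (intro mult_right_mono) auto
    also have "\<dots> \<le> (real n - 1) * (2 / 10 ^ 22)" using n by simp
    finally show ?thesis .
  qed
  \<comment> \<open>\<open>m + 1\<close> is the size of the interval that contains the rescaled set \<open>B\<close>\<close>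
  have "real_of_int m + 1 \<le> real n + \<epsilon> * real n + 1682000 * (\<epsilon> * real n)\<^sup>2 / real n"
    by (rule S.normalised_stability(1)[OF gcd e])
  also have "1682000 * (\<epsilon> * real n)\<^sup>2 / real n = 1682000 * \<epsilon>\<^sup>2 * real n"
    using n by (simp add: power2_eq_square)
  also have "1682000 * \<epsilon>\<^sup>2 * real n \<le> 2000000 * \<epsilon>\<^sup>2 * real n"
    by (intro mult_right_mono) auto
  finally have m_le: "real_of_int (m + 1) \<le> (1 + \<epsilon> + 2000000 * \<epsilon>\<^sup>2) * real n"
    by (simp add: algebra_simps)
  have pos: "(1 + \<epsilon> + 2000000 * \<epsilon>\<^sup>2) * real n \<ge> real n"
  proof -
    have "1 * real n \<le> (1 + \<epsilon> + 2000000 * \<epsilon>\<^sup>2) * real n" using \<epsilon>0 by (intro mult_right_mono) auto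
    thus ?thesis by simp
  qed
  have N: "int N = \<lfloor>(1 + \<epsilon> + 2000000 * \<epsilon>\<^sup>2) * real n\<rfloor>"
    using pos by (simp add: N_def)
  have mN: "m + 1 \<le> int N" unfolding N le_floor_iff by (rule m_le)
  have nN: "n \<le> N"
  proof -
    have "int n \<le> int N" unfolding N le_floor_iff using pos by simp
    thus ?thesis by simp
  qed
  have Nn: "real N - real n \<le> 2 * \<epsilon> * real n"
  proof -
    have "real N \<le> (1 + \<epsilon> + 2000000 * \<epsilon>\<^sup>2) * real n"
      using of_int_floor_le[of "(1 + \<epsilon> + 2000000 * \<epsilon>\<^sup>2) * real n"] unfolding N [symmetric] by simp
    moreover have "2000000 * \<epsilon>\<^sup>2 \<le> \<epsilon>"
    proof -
      have "(2000000 * \<epsilon>) * \<epsilon> \<le> 1 * \<epsilon>" using \<epsilon> \<epsilon>0 by (intro mult_right_mono) auto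
      thus ?thesis by (simp add: power2_eq_square)
    qed
    hence "(1 + \<epsilon> + 2000000 * \<epsilon>\<^sup>2) * real n \<le> (1 + \<epsilon> + \<epsilon>) * real n"
      by (intro mult_right_mono) auto
    ultimately show ?thesis by (simp add: algebra_simps)
  qed
  obtain t where t: "real (card (sym_diff (\<phi> ` A) {t..<t + int n})) \<le> 580 * (\<epsilon> * real n)"
    using S.normalised_stability(2)[OF gcd e] by blast
  let ?P' = "{t..<t + int N}"
  have P': "real (card (sym_diff (\<phi> ` A) ?P')) \<le> 582 * \<epsilon> * real n"
  proof -
    have "card (sym_diff (\<phi> ` A) ?P') \<le> card (sym_diff (\<phi> ` A) {t..<t + int n} \<union> {t + int n..<t + int N})"
      using finA nN by (intro card_mono) auto
    also have "\<dots> \<le> card (sym_diff (\<phi> ` A) {t..<t + int n}) + card {t + int n..<t + int N}"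
      by (rule card_Un_le)
    finally have "real (card (sym_diff (\<phi> ` A) ?P')) \<le>
        real (card (sym_diff (\<phi> ` A) {t..<t + int n})) + real (N - n)" by simp
    thus ?thesis using t Nn nN by (simp add: of_nat_diff)
  qed
  \<comment> \<open>so the interval singles out a class, that of \<open>x0\<close>\<close>
  have "\<phi> ` A \<inter> ?P' \<noteq> {}"
  proof
    assume "\<phi> ` A \<inter> ?P' = {}"
    hence "card (\<phi> ` A) \<le> card (sym_diff (\<phi> ` A) ?P')" using finA by (intro card_mono) auto
    hence "real n \<le> 582 * \<epsilon> * real n" using P' S.cardA by linarith
    moreover have "582 * \<epsilon> * real n < 1 * real n" using \<epsilon> n by (intro mult_strict_right_mono) auto
    ultimately show False by simp
  qed
  then obtain x0 where x0: "x0 \<in> A" "\<phi> x0 \<in> ?P'" by blast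
  define j where "j = x0 mod D"
  define P where "P = {(t - j * M) * D + j + int i * D | i. i < N}"
  define Q where "Q = {b0 + int i * D | i. i < N}"
  have P_image: "P = (\<lambda>i. (t - j * M) * D + j + int i * D) ` {..<N}" by (auto simp: P_def)
  have cardP: "card P = N" unfolding P_image using D by (subst card_image) (auto simp: inj_on_def)
  have finP: "finite P" by (simp add: P_image)
  have "\<phi> ` A \<inter> ?P' \<subseteq> \<phi> ` (A \<inter> P)"
  proof
    fix y assume "y \<in> \<phi> ` A \<inter> ?P'"
    then obtain x where x: "x \<in> A" "y = \<phi> x" "\<phi> x \<in> ?P'" by blast
    have xj: "x mod D = j" unfolding j_def using x(3) x0(2) by (intro same_class x(1) x0(1)) auto
    have "x div D = \<phi> x - j * M" by (simp add: \<phi>_def xj)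
    hence i: "x div D - (t - j * M) \<ge> 0" "x div D - (t - j * M) < int N" using x(3) by auto
    have "x = (x div D) * D + j" using xj by (metis div_mult_mod_eq)
    hence "x = (t - j * M) * D + j + int (nat (x div D - (t - j * M))) * D"
      using i by (simp add: algebra_simps)
    moreover have "nat (x div D - (t - j * M)) < N" using i by linarith
    ultimately have "x \<in> P" unfolding P_def by blast
    thus "y \<in> \<phi> ` (A \<inter> P)" using x by blast
  qed
  hence "card (\<phi> ` A \<inter> ?P') \<le> card (A \<inter> P)"
    using finA by (intro surj_card_le) auto
  moreover have "card (sym_diff A P) + 2 * card (A \<inter> P) = n + N"
    using card_sym_diff_eq[OF finA finP] cardA cardP by simp
  moreover have "card (sym_diff (\<phi> ` A) ?P') + 2 * card (\<phi> ` A \<inter> ?P') = n + N"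
    using card_sym_diff_eq[of "\<phi> ` A" ?P'] finA S.cardA by simp
  ultimately have "card (sym_diff A P) \<le> card (sym_diff (\<phi> ` A) ?P')" by linarith
  hence "real (card (sym_diff A P)) \<le> 582 * \<epsilon> * real n" using P' by linarith
  also have "\<dots> \<le> 2000000 * \<epsilon> * real n" using \<epsilon>0 by (intro mult_right_mono) auto
  finally have AP: "real (card (sym_diff A P)) \<le> 2000000 * \<epsilon> * real n" .
  have "B \<subseteq> Q"
  proof
    fix b assume b: "b \<in> B"
    have "0 \<le> \<beta> b" "\<beta> b \<le> m" using \<beta>_mono[OF b0(2)[OF b]] \<beta>_mono[OF b1(2)[OF b]] \<beta>0 by (auto simp: m_def)
    hence "nat (\<beta> b) < N" "int (nat (\<beta> b)) = \<beta> b" using mN by auto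
    moreover from this have "b = b0 + int (nat (\<beta> b)) * D" using \<beta>[OF b] by (simp add: algebra_simps)
    ultimately show "b \<in> Q" unfolding Q_def by blast
  qed
  moreover have "is_arith_prog D N P" "is_arith_prog D N Q"
    using D by (auto simp: is_arith_prog_def P_def Q_def)
  ultimately show ?thesis using N AP by blast
qed

theorem theorem2:
  shows "\<exists>c \<epsilon>\<^sub>0 :: real. c > 0 \<and> \<epsilon>\<^sub>0 > 0 \<and>
    (\<forall>\<epsilon> < \<epsilon>\<^sub>0. \<forall>(A :: int set) (B :: int set) (n :: nat).
       finite A \<longrightarrow> A \<noteq> {} \<longrightarrow> finite B \<longrightarrow> B \<noteq> {} \<longrightarrow> n = card A \<longrightarrow> n = card B \<longrightarrow>
       (\<forall>b1\<in>B. \<forall>b2\<in>B. \<forall>b3\<in>B. \<forall>b4\<in>B.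
          real (card (A + {b1, b2, b3, b4})) \<le> (2 + \<epsilon>) * real n - 1) \<longrightarrow>
       (\<exists>P Q d N. int N = \<lfloor>(1 + \<epsilon> + c * \<epsilon>\<^sup>2) * real n\<rfloor> \<and>
          is_arith_prog d N P \<and> is_arith_prog d N Q \<and>
          B \<subseteq> Q \<and> real (card (sym_diff A P)) \<le> c * \<epsilon> * real n))"
proof (rule exI[of _ 2000000], rule exI[of _ "1 / 10 ^ 22"], intro conjI allI impI)
  fix \<epsilon> :: real and A B :: "int set" and n :: nat
  assume \<epsilon>: "\<epsilon> < 1 / 10 ^ 22" and A: "finite A" "A \<noteq> {}" and B: "finite B" "B \<noteq> {}"
    and n: "n = card A" "n = card B"
    and four: "\<forall>b1\<in>B. \<forall>b2\<in>B. \<forall>b3\<in>B. \<forall>b4\<in>B.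
          real (card (A + {b1, b2, b3, b4})) \<le> (2 + \<epsilon>) * real n - 1"
  show "\<exists>P Q d N. int N = \<lfloor>(1 + \<epsilon> + 2000000 * \<epsilon>\<^sup>2) * real n\<rfloor> \<and>
          is_arith_prog d N P \<and> is_arith_prog d N Q \<and>
          B \<subseteq> Q \<and> real (card (sym_diff A P)) \<le> 2000000 * \<epsilon> * real n"
  proof (cases "n \<ge> 2")
    case True
    show ?thesis using four n by (intro arith_prog_stability A B True \<epsilon>) auto
  next
    case False
    hence n1: "n = 1" using n(1) A by (cases n) auto
    obtain a where a: "A = {a}" using n n1 by (metis card_1_singletonE)
    obtain b where b: "B = {b}" using n n1 by (metis card_1_singletonE)
    have "\<epsilon> \<ge> 0" using four by (simp add: a b n1 set_plus_def)
    have "\<epsilon> + 2000000 * \<epsilon>\<^sup>2 < 1"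
    proof -
      have "\<epsilon>\<^sup>2 \<le> 1 * \<epsilon>" unfolding power2_eq_square using \<epsilon> \<open>\<epsilon> \<ge> 0\<close> by (intro mult_right_mono) auto
      thus ?thesis using \<epsilon> by simp
    qed
    hence "int 1 = \<lfloor>(1 + \<epsilon> + 2000000 * \<epsilon>\<^sup>2) * real n\<rfloor>"
      using \<open>\<epsilon> \<ge> 0\<close> unfolding n1 by (simp add: eq_commute[of 1] floor_eq_iff)
    moreover have "is_arith_prog 1 1 A" "is_arith_prog 1 1 B"
      by (auto simp: is_arith_prog_def a b)
    moreover have "real (card (sym_diff A A)) \<le> 2000000 * \<epsilon> * real n" using \<open>\<epsilon> \<ge> 0\<close> by simp
    ultimately show ?thesis by blast
  qed
qed auto

end
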